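(* For every $n\geq 0$, the colorful exchange graph $\mathcal{G}^{c}_n$ of a convex $(n+3)$-gon $N$ is the $1$-skeleton of a simple abstract polytope of rank $n$, namely its colorful polytope (called the colorful $n$-associahedron $\mathcal{A}^{c}_n$).
   Context: Let $N$ be a convex $(n+3)$-gon with vertices $1,\ldots,n+3$ in cyclic order, and $C(N)$ a set of $n$ colors. A colored triangulation of $N$ is a triangulation of $N$ (with $n$ diagonals) whose diagonals are assigned pairwise distinct colors from $C(N)$. Flipping a diagonal $d$ replaces $d$ by the other diagonal of the quadrilateral formed by the two triangles containing $d$, keeping its color. $\mathcal{G}^{c}_n$ has vertices the colored triangulations, adjacency by single flips, and each edge is colored by the color of the flipped diagonal (a proper edge coloring with color set $R=C(N)$). Colorful polytope: for a connected $n$-regular graph $\mathcal{G}$ with a proper edge coloring by an $n$-element color set $R$, and for $C\subseteq R$, write $v\sim_C w$ if there is a path from $v$ to $w$ all of whose edges have colors in $C$. The colorful polytope $\mathcal{P}_{\mathcal{G}}$ is the poset consisting of a least element (rank $-1$) together with, for each $j=0,\ldots,n$, the faces of rank $j$, which are the pairs $(C,X)$ with $C\subseteq R$, $|C|=j$, and $X$ a $\sim_C$-equivalence class of vertices; ordered by $(C,X)\le(C',X')$ iff $C\subseteq C'$ and $X\subseteq X'$. Abstract polytopes are in the sense of McMullen–Schulte; an abstract polytope of rank $n$ is simple if all its vertex-figures are isomorphic to $(n-1)$-simplices; its $1$-skeleton is the graph formed by its vertices (rank $0$) and edges (rank $1$). *)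

theory Defs
  imports Main
begin

section \<open>Abstract polytopes\<close>

text \<open>A poset is given by its (reflexive) order relation \<open>r\<close>; its faces are the elements of
  \<open>Field r\<close>.\<close>

definition flags :: "'a rel \<Rightarrow> 'a set set" where
  "flags r = {\<Phi> \<in> Chains r. \<forall>\<Psi> \<in> Chains r. \<Phi> \<subseteq> \<Psi> \<longrightarrow> \<Psi> = \<Phi>}"

text \<open>Ranks are integers because the one-element poset has rank \<open>-1\<close>: a poset of rank \<open>k\<close> is one
  all of whose flags have \<open>k + 2\<close> elements. Since flags exist, there is at most one such \<open>k\<close>.\<close>

definition flags_of_rank :: "int \<Rightarrow> 'a rel \<Rightarrow> bool" where
  "flags_of_rank k r \<longleftrightarrow> (\<forall>\<Phi> \<in> flags r. finite \<Phi> \<and> int (card \<Phi>) = k + 2)"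

definition poset_rank :: "'a rel \<Rightarrow> int" where
  "poset_rank r = (THE k. flags_of_rank k r)"

definition poset_section :: "'a rel \<Rightarrow> 'a \<Rightarrow> 'a \<Rightarrow> 'a rel" where
  "poset_section r F G = Restr r {H. (F, H) \<in> r \<and> (H, G) \<in> r}"

definition is_least_face :: "'a rel \<Rightarrow> 'a \<Rightarrow> bool" where
  "is_least_face r F \<longleftrightarrow> F \<in> Field r \<and> (\<forall>G \<in> Field r. (F, G) \<in> r)"

definition is_greatest_face :: "'a rel \<Rightarrow> 'a \<Rightarrow> bool" where
  "is_greatest_face r F \<longleftrightarrow> F \<in> Field r \<and> (\<forall>G \<in> Field r. (G, F) \<in> r)"

text \<open>The rank of a face \<open>F\<close> is the rank of the section between the least face and \<open>F\<close>.\<close>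

definition face_rank :: "'a rel \<Rightarrow> 'a \<Rightarrow> int" where
  "face_rank r F = poset_rank (Restr r {H. (H, F) \<in> r})"

definition faces_of_rank :: "'a rel \<Rightarrow> int \<Rightarrow> 'a set" where
  "faces_of_rank r j = {F \<in> Field r. face_rank r F = j}"

definition proper_faces :: "'a rel \<Rightarrow> 'a set" where
  "proper_faces r = {F \<in> Field r. \<not> is_least_face r F \<and> \<not> is_greatest_face r F}"

definition poset_connected :: "'a rel \<Rightarrow> bool" where
  "poset_connected r \<longleftrightarrow> poset_rank r \<le> 1 \<or>
     (\<forall>F \<in> proper_faces r. \<forall>G \<in> proper_faces r.
        (F, G) \<in> {(H, K). H \<in> proper_faces r \<and> K \<in> proper_faces r \<and>
                          ((H, K) \<in> r \<or> (K, H) \<in> r)}\<^sup>*)"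

text \<open>McMullen and Schulte's axioms (P1) to (P4); (P3) is strong connectedness: the connectedness
  of all sections.\<close>

definition abstract_polytope :: "int \<Rightarrow> 'a rel \<Rightarrow> bool" where
  "abstract_polytope n r \<longleftrightarrow>
     Partial_order r \<and>
     (\<exists>F. is_least_face r F) \<and> (\<exists>F. is_greatest_face r F) \<and>
     flags_of_rank n r \<and>
     (\<forall>F G. (F, G) \<in> r \<longrightarrow> poset_connected (poset_section r F G)) \<and>
     (\<forall>i. \<forall>F \<in> faces_of_rank r (i - 1). \<forall>G \<in> faces_of_rank r (i + 1). (F, G) \<in> r \<longrightarrow>
        card {H \<in> faces_of_rank r i. (F, H) \<in> r \<and> (H, G) \<in> r} = 2)"

definition poset_isomorphic :: "'a rel \<Rightarrow> 'b rel \<Rightarrow> bool" where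
  "poset_isomorphic r s \<longleftrightarrow> (\<exists>f. bij_betw f (Field r) (Field s) \<and>
     (\<forall>x \<in> Field r. \<forall>y \<in> Field r. (x, y) \<in> r \<longleftrightarrow> (f x, f y) \<in> s))"

text \<open>The face poset of the \<open>d\<close>-simplex, \<open>d \<ge> -1\<close>: all subsets of a set of \<open>d + 1\<close> elements.\<close>

definition simplex_poset :: "int \<Rightarrow> nat set rel" where
  "simplex_poset d = {(A, B). A \<subseteq> B \<and> B \<subseteq> {i. int i \<le> d}}"

text \<open>The vertex-figure at \<open>v\<close> is the section between \<open>v\<close> and the greatest face.\<close>

definition vertex_figure :: "'a rel \<Rightarrow> 'a \<Rightarrow> 'a rel" where
  "vertex_figure r v = Restr r {H. (v, H) \<in> r}"

definition simple_abstract_polytope :: "int \<Rightarrow> 'a rel \<Rightarrow> bool" where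
  "simple_abstract_polytope n r \<longleftrightarrow> abstract_polytope n r \<and>
     (\<forall>v \<in> faces_of_rank r 0. poset_isomorphic (vertex_figure r v) (simplex_poset (n - 1)))"

text \<open>The graph with vertex set \<open>V\<close> and edge set \<open>E\<close> (edges are two-element sets of vertices) is,
  up to isomorphism, the 1-skeleton of \<open>r\<close>. Mapping edges by a bijection of their own excludes
  multiple edges in the 1-skeleton.\<close>

definition is_one_skeleton :: "'v set \<Rightarrow> 'v set set \<Rightarrow> 'a rel \<Rightarrow> bool" where
  "is_one_skeleton V E r \<longleftrightarrow> (\<exists>f g.
     bij_betw f V (faces_of_rank r 0) \<and> bij_betw g E (faces_of_rank r 1) \<and>
     (\<forall>v \<in> V. \<forall>e \<in> E. v \<in> e \<longleftrightarrow> (f v, g e) \<in> r))"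


section \<open>Colorful polytopes\<close>

definition color_equiv :: "'v set \<Rightarrow> 'v set set \<Rightarrow> ('v set \<Rightarrow> 'c) \<Rightarrow> 'c set \<Rightarrow> 'v rel" where
  "color_equiv V E \<kappa> C =
     {(v, w). v \<in> V \<and> w \<in> V \<and> (v, w) \<in> {(x, y). {x, y} \<in> E \<and> \<kappa> {x, y} \<in> C}\<^sup>*}"

definition properly_edge_colored_regular_graph ::
    "nat \<Rightarrow> 'c set \<Rightarrow> 'v set \<Rightarrow> 'v set set \<Rightarrow> ('v set \<Rightarrow> 'c) \<Rightarrow> bool" where
  "properly_edge_colored_regular_graph n R V E \<kappa> \<longleftrightarrow>
     finite R \<and> card R = n \<and>
     (\<forall>e \<in> E. e \<subseteq> V \<and> card e = 2) \<and>
     (\<forall>v \<in> V. finite {e \<in> E. v \<in> e} \<and> card {e \<in> E. v \<in> e} = n) \<and>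
     (\<forall>e \<in> E. \<kappa> e \<in> R) \<and>
     (\<forall>e \<in> E. \<forall>e' \<in> E. e \<noteq> e' \<and> e \<inter> e' \<noteq> {} \<longrightarrow> \<kappa> e \<noteq> \<kappa> e')"

definition connected_graph :: "'v set \<Rightarrow> 'v set set \<Rightarrow> bool" where
  "connected_graph V E \<longleftrightarrow> V \<noteq> {} \<and> (\<forall>v \<in> V. \<forall>w \<in> V. (v, w) \<in> {(x, y). {x, y} \<in> E}\<^sup>*)"

text \<open>\<open>None\<close> is the least face; \<open>Some (C, X)\<close> is the face \<open>(C, X)\<close>, intended to have rank
  \<open>card C\<close>.\<close>

type_synonym ('v, 'c) colorful_face = "('c set \<times> 'v set) option"

definition colorful_faces ::
    "'c set \<Rightarrow> 'v set \<Rightarrow> 'v set set \<Rightarrow> ('v set \<Rightarrow> 'c) \<Rightarrow> ('v, 'c) colorful_face set" where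
  "colorful_faces R V E \<kappa> =
     insert None (Some ` {(C, X). C \<subseteq> R \<and> X \<in> V // color_equiv V E \<kappa> C})"

fun colorful_face_le :: "('v, 'c) colorful_face \<Rightarrow> ('v, 'c) colorful_face \<Rightarrow> bool" where
  "colorful_face_le None G \<longleftrightarrow> True"
| "colorful_face_le (Some (C, X)) None \<longleftrightarrow> False"
| "colorful_face_le (Some (C, X)) (Some (C', X')) \<longleftrightarrow> C \<subseteq> C' \<and> X \<subseteq> X'"

definition colorful_polytope ::
    "'c set \<Rightarrow> 'v set \<Rightarrow> 'v set set \<Rightarrow> ('v set \<Rightarrow> 'c) \<Rightarrow> ('v, 'c) colorful_face rel" where
  "colorful_polytope R V E \<kappa> =
     {(F, G). F \<in> colorful_faces R V E \<kappa> \<and> G \<in> colorful_faces R V E \<kappa> \<and> colorful_face_le F G}"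


section \<open>The colorful exchange graph of a convex polygon\<close>

text \<open>The convex \<open>(n + 3)\<close>-gon is treated combinatorially: its vertices are \<open>1, \<dots>, n + 3\<close> in
  cyclic order, a segment between two vertices is the set of its endpoints, and by convexity two
  diagonals cross in their interiors iff their endpoints alternate along the boundary.\<close>

definition polygon_sides :: "nat \<Rightarrow> nat set set" where
  "polygon_sides n = insert {n + 3, 1} {{i, i + 1} | i. 1 \<le> i \<and> i < n + 3}"

definition diagonals :: "nat \<Rightarrow> nat set set" where
  "diagonals n =
     {{i, j} | i j. i \<in> {1..n + 3} \<and> j \<in> {1..n + 3} \<and> i \<noteq> j} - polygon_sides n"

definition crosses :: "nat set \<Rightarrow> nat set \<Rightarrow> bool" where
  "crosses d e \<longleftrightarrow> (\<exists>a b c f. a < b \<and> b < c \<and> c < f \<and>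
     (d = {a, c} \<and> e = {b, f} \<or> d = {b, f} \<and> e = {a, c}))"

definition noncrossing :: "nat \<Rightarrow> nat set set \<Rightarrow> bool" where
  "noncrossing n T \<longleftrightarrow> T \<subseteq> diagonals n \<and> (\<forall>d \<in> T. \<forall>e \<in> T. \<not> crosses d e)"

definition triangulation :: "nat \<Rightarrow> nat set set \<Rightarrow> bool" where
  "triangulation n T \<longleftrightarrow> noncrossing n T \<and> (\<forall>T'. noncrossing n T' \<and> T \<subseteq> T' \<longrightarrow> T' = T)"

text \<open>Three vertices pairwise joined by sides or diagonals in \<open>T\<close>. As all vertices lie on the
  boundary, these are exactly the triangles into which \<open>T\<close> dissects the polygon.\<close>

definition triangle_of :: "nat \<Rightarrow> nat set set \<Rightarrow> nat set \<Rightarrow> bool" where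
  "triangle_of n T \<Delta> \<longleftrightarrow> card \<Delta> = 3 \<and>
     (\<forall>a \<in> \<Delta>. \<forall>b \<in> \<Delta>. a \<noteq> b \<longrightarrow> {a, b} \<in> polygon_sides n \<union> T)"

text \<open>A coloring is a partial map from diagonals to colors whose domain is the triangulation.\<close>

definition colored_triangulations :: "nat \<Rightarrow> 'c set \<Rightarrow> (nat set \<rightharpoonup> 'c) set" where
  "colored_triangulations n R = {t. triangulation n (dom t) \<and> ran t \<subseteq> R \<and> inj_on t (dom t)}"

text \<open>The diagonal \<open>d = {a, c}\<close> of \<open>T\<close> lies in the two triangles \<open>{a, b, c}\<close> and \<open>{a, c, f}\<close>,
  and \<open>d' = {b, f}\<close> is the other diagonal of the quadrilateral \<open>a, b, c, f\<close>.\<close>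

definition opposite_diagonal :: "nat \<Rightarrow> nat set set \<Rightarrow> nat set \<Rightarrow> nat set \<Rightarrow> bool" where
  "opposite_diagonal n T d d' \<longleftrightarrow> d \<in> T \<and>
     (\<exists>a b c f. d = {a, c} \<and> d' = {b, f} \<and> b \<noteq> f \<and>
        triangle_of n T {a, b, c} \<and> triangle_of n T {a, c, f})"

definition flips_to :: "nat \<Rightarrow> (nat set \<rightharpoonup> 'c) \<Rightarrow> nat set \<Rightarrow> (nat set \<rightharpoonup> 'c) \<Rightarrow> bool" where
  "flips_to n t d t' \<longleftrightarrow>
     (\<exists>d'. opposite_diagonal n (dom t) d d' \<and> t' = t(d := None, d' := t d))"

definition exchange_edges :: "nat \<Rightarrow> 'c set \<Rightarrow> (nat set \<rightharpoonup> 'c) set set" where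
  "exchange_edges n R =
     {{t, t'} | t t' d. t \<in> colored_triangulations n R \<and> t' \<in> colored_triangulations n R \<and>
                        flips_to n t d t'}"

text \<open>The color of the flipped diagonal; it does not depend on the direction in which the edge is
  traversed, because the new diagonal inherits the color.\<close>

definition exchange_color :: "nat \<Rightarrow> 'c set \<Rightarrow> (nat set \<rightharpoonup> 'c) set \<Rightarrow> 'c" where
  "exchange_color n R e =
     (THE k. \<exists>t t' d. e = {t, t'} \<and> t \<in> colored_triangulations n R \<and>
                      t' \<in> colored_triangulations n R \<and> flips_to n t d t' \<and> t d = Some k)"

definition colorful_associahedron ::
    "nat \<Rightarrow> 'c set \<Rightarrow> (nat set \<rightharpoonup> 'c, 'c) colorful_face rel" where
  "colorful_associahedron n R =
     colorful_polytope R (colored_triangulations n R) (exchange_edges n R) (exchange_color n R)"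

end

theory Submission
  imports Defs
begin

text \<open>Above a vertex \<open>v\<close> of a colored graph, the faces are the \<open>(C, [v])\<close>, so every section not
  containing the least face is a Boolean lattice; this gives the diamond condition and the simplicial
  vertex-figures, while sections below are connected because a color component is connected through
  its own edges.

  For the exchange graph, each diagonal of a triangulation has a unique apex on either side, which
  yields the flips; counting the segments inside each segment shows that triangulations are exactly
  the noncrossing sets of \<open>n\<close> diagonals, so that flips preserve them. Every triangulation can be
  flipped to the fan at vertex 1, and in the fan the five flips around a pentagon transpose the colors
  of two neighboring diagonals, so all colorings of the fan are connected to each other.\<close>


section \<open>Graded posets\<close>

text \<open>Ranks are defined from the size of flags by a definite description, while faces come
  with the obvious candidate \<open>card C\<close>. The bridge is a strictly monotone function that
  leaves no gaps: flag sizes, section ranks and face ranks all become differences of its values. On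
  the polygon, the obstacle is that diagonals are unordered and their triangles may lie on either
  side. Segments are therefore oriented by \<open>i < j\<close>, and sides are treated like
  diagonals, so that a triangulation becomes a full binary tree below the side
  \<open>{1, n + 3}\<close>; its size gives the count of diagonals. Colors travel with the
  diagonals, so connecting the uncolored triangulations is not enough: closed walks must realize all
  permutations of colors. Five is odd: the flips around a pentagon move its two colors alternately,
  three times and twice, and return to the same triangulation with the colors exchanged.\<close>

locale graded_poset =
  fixes r :: "'a rel" and rk :: "'a \<Rightarrow> int" and L U :: 'a
  assumes partial_order: "Partial_order r"
    and least: "is_least_face r L"
    and greatest: "is_greatest_face r U"
    and rk_less: "\<And>F G. (F, G) \<in> r \<Longrightarrow> F \<noteq> G \<Longrightarrow> rk F < rk G"
    and interpolate: "\<And>F G. (F, G) \<in> r \<Longrightarrow> rk F + 1 < rk G \<Longrightarrow>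
      \<exists>H. (F, H) \<in> r \<and> (H, G) \<in> r \<and> H \<noteq> F \<and> H \<noteq> G"
begin

lemma refl_face: "F \<in> Field r \<Longrightarrow> (F, F) \<in> r"
  using partial_order by (auto simp: partial_order_on_def preorder_on_def refl_on_def)

lemma trans_face: "(F, G) \<in> r \<Longrightarrow> (G, H) \<in> r \<Longrightarrow> (F, H) \<in> r"
  using partial_order by (auto simp: partial_order_on_def preorder_on_def dest: transD)

lemma antisym_face: "(F, G) \<in> r \<Longrightarrow> (G, F) \<in> r \<Longrightarrow> F = G"
  using partial_order by (auto simp: partial_order_on_def dest: antisymD)

lemma rk_le: "(F, G) \<in> r \<Longrightarrow> rk F \<le> rk G"
  using rk_less[of F G] by (cases "F = G") auto

lemma chain_Field: "\<Phi> \<in> Chains r \<Longrightarrow> F \<in> \<Phi> \<Longrightarrow> F \<in> Field r"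
  unfolding Chains_def by (auto simp: Field_def)

lemma chain_total: "\<Phi> \<in> Chains r \<Longrightarrow> F \<in> \<Phi> \<Longrightarrow> G \<in> \<Phi> \<Longrightarrow> (F, G) \<in> r \<or> (G, F) \<in> r"
  unfolding Chains_def by blast

lemma chain_inj: "\<Phi> \<in> Chains r \<Longrightarrow> inj_on rk \<Phi>"
  by (rule inj_onI) (metis chain_total rk_less less_irrefl)

lemma chain_rk_less: "\<Phi> \<in> Chains r \<Longrightarrow> F \<in> \<Phi> \<Longrightarrow> G \<in> \<Phi> \<Longrightarrow> rk F < rk G \<Longrightarrow> (F, G) \<in> r"
  using chain_total rk_le by (meson not_le)

lemma rk_bounds: "F \<in> Field r \<Longrightarrow> rk F \<in> {rk L..rk U}"
  using least greatest rk_le by (auto simp: is_least_face_def is_greatest_face_def)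

lemma chain_image: "\<Phi> \<in> Chains r \<Longrightarrow> rk ` \<Phi> \<subseteq> {rk L..rk U}"
  using chain_Field rk_bounds by blast

lemma chain_finite: "\<Phi> \<in> Chains r \<Longrightarrow> finite \<Phi>"
  using chain_image chain_inj by (meson finite_atLeastAtMost_int finite_subset finite_imageD)

lemma flag_insert:
  assumes "\<Phi> \<in> flags r" and "H \<in> Field r" and "\<And>K. K \<in> \<Phi> \<Longrightarrow> (K, H) \<in> r \<or> (H, K) \<in> r"
  shows "H \<in> \<Phi>"
proof -
  have "insert H \<Phi> \<in> Chains r"
    using assms refl_face unfolding flags_def Chains_def by auto
  then show ?thesis
    using assms(1) unfolding flags_def by blast
qed

text \<open>If a value \<open>i\<close> were skipped, the last face \<open>F\<close> of the flag
  below \<open>i\<close> and the first face \<open>G\<close> above it would have a rank gap of at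
  least 2. A face inserted between them is comparable with the whole flag, so maximality puts it
  there, against the choice of \<open>F\<close> or \<open>G\<close>.\<close>

lemma flag_image:
  assumes "\<Phi> \<in> flags r"
  shows "rk ` \<Phi> = {rk L..rk U}"
proof
  have ch: "\<Phi> \<in> Chains r"
    using assms by (simp add: flags_def)
  then show "rk ` \<Phi> \<subseteq> {rk L..rk U}"
    by (rule chain_image)
  have LU: "L \<in> \<Phi>" "U \<in> \<Phi>"
    using assms ch least greatest chain_Field
    by (auto simp: is_least_face_def is_greatest_face_def intro!: flag_insert)
  show "{rk L..rk U} \<subseteq> rk ` \<Phi>"
  proof (rule ccontr)
    assume "\<not> ?thesis"
    then obtain i where "i \<in> {rk L..rk U}" and i: "i \<notin> rk ` \<Phi>"
      by blast
    then have i: "rk L \<le> i" "i \<le> rk U" "i \<notin> rk ` \<Phi>"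
      by auto
    let ?A = "{F \<in> \<Phi>. rk F < i}" and ?B = "{F \<in> \<Phi>. i < rk F}"
    have fin: "finite ?A" "finite ?B"
      using chain_finite[OF ch] by auto
    have "L \<in> ?A" "U \<in> ?B"
      using i LU by (auto simp: image_iff order.order_iff_strict)
    then have ne: "?A \<noteq> {}" "?B \<noteq> {}"
      by blast+
    obtain F where F: "F \<in> ?A" "rk F = Max (rk ` ?A)"
      using Max_in[of "rk ` ?A"] fin ne by (auto simp del: Max_in)
    obtain G where G: "G \<in> ?B" "rk G = Min (rk ` ?B)"
      using Min_in[of "rk ` ?B"] fin ne by (auto simp del: Min_in)
    have Fmax: "rk K \<le> rk F" if "K \<in> ?A" for K
      using F fin that by simp
    have Gmin: "rk G \<le> rk K" if "K \<in> ?B" for K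
      using G fin that by simp
    have "(F, G) \<in> r"
      using F G chain_rk_less[OF ch] by auto
    then obtain H where H: "(F, H) \<in> r" "(H, G) \<in> r" "H \<noteq> F" "H \<noteq> G"
      using interpolate[of F G] F G by auto
    have "H \<in> \<Phi>"
    proof (rule flag_insert[OF assms])
      show "H \<in> Field r"
        using H by (auto simp: Field_def)
      fix K assume K: "K \<in> \<Phi>"
      then have "K \<in> ?A \<or> K \<in> ?B"
        using i by (auto simp: image_iff)
      then have "rk K \<le> rk F \<or> rk G \<le> rk K"
        using Fmax Gmin by blast
      then have "(K, F) \<in> r \<or> (G, K) \<in> r"
        using ch K F G chain_total rk_le rk_less
        by (metis (no_types, lifting) antisym_face mem_Collect_eq not_le)
      then show "(K, H) \<in> r \<or> (H, K) \<in> r"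
        using H trans_face by blast
    qed
    then have "H \<in> ?A \<or> H \<in> ?B"
      using i by (auto simp: image_iff)
    then show False
      using Fmax Gmin rk_less H by force
  qed
qed

text \<open>In a poset without flags \<open>flags_of_rank\<close> would hold for every
  \<open>k\<close>, so this makes the description in \<open>poset_rank\<close> unique. Chains embed
  into an integer interval by \<open>rk\<close>, so one of largest cardinality exists, and it is
  maximal.\<close>

lemma flags_nonempty: "flags r \<noteq> {}"
proof -
  have card_le: "card \<Phi> \<le> nat (rk U - rk L + 1)" if "\<Phi> \<in> Chains r" for \<Phi>
    using card_mono[OF _ chain_image[OF that]] card_image[OF chain_inj[OF that]] by simp
  have "{} \<in> Chains r"
    by (simp add: Chains_def)
  then obtain \<Phi> where \<Phi>: "\<Phi> \<in> Chains r" "\<And>\<Psi>. \<Psi> \<in> Chains r \<Longrightarrow> card \<Psi> \<le> card \<Phi>"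
    using ex_has_greatest_nat[of "\<lambda>\<Phi>. \<Phi> \<in> Chains r" "{}" card] card_le
    by (metis le_imp_less_Suc)
  moreover have "\<Psi> = \<Phi>" if "\<Psi> \<in> Chains r" "\<Phi> \<subseteq> \<Psi>" for \<Psi>
    using card_seteq[OF chain_finite[OF that(1)] that(2)] \<Phi>(2)[OF that(1)] by simp
  ultimately have "\<Phi> \<in> flags r"
    by (simp add: flags_def)
  then show ?thesis
    by blast
qed

text \<open>A flag has one face for each value from \<open>rk L\<close> to \<open>rk U\<close>, so
  \<open>k + 2 = rk U - rk L + 1\<close>.\<close>

lemma flags_of_rank_iff: "flags_of_rank k r \<longleftrightarrow> k = rk U - rk L - 1"
proof -
  have "rk L \<le> rk U"
    using least greatest rk_le by (auto simp: is_least_face_def is_greatest_face_def)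
  then have "finite \<Phi> \<and> int (card \<Phi>) = rk U - rk L + 1" if "\<Phi> \<in> flags r" for \<Phi>
    using that flag_image[OF that] chain_finite card_image[OF chain_inj[of \<Phi>]]
    by (auto simp: flags_def)
  then show ?thesis
    using flags_nonempty unfolding flags_of_rank_def by fastforce
qed

lemma poset_rank_eq: "poset_rank r = rk U - rk L - 1"
  unfolding poset_rank_def by (simp add: flags_of_rank_iff)

section \<open>Sections and ranks of faces\<close>

lemma Field_section:
  assumes "(F, G) \<in> r"
  shows "Field (poset_section r F G) = {H. (F, H) \<in> r \<and> (H, G) \<in> r}"
  using refl_face unfolding poset_section_def Field_def by auto

text \<open>\<open>rk\<close> is not normalized at the least face, so a section is graded by the
  same function and only the two ends change.\<close>

lemma graded_section:
  assumes FG: "(F, G) \<in> r"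
  shows "graded_poset (poset_section r F G) rk F G"
proof
  have FG_Field: "F \<in> Field r" "G \<in> Field r"
    using FG by (auto simp: Field_def)
  have "antisym (poset_section r F G)" "trans (poset_section r F G)"
    using antisym_face trans_face
    unfolding poset_section_def antisym_def trans_def by blast+
  moreover have "refl_on (Field (poset_section r F G)) (poset_section r F G)"
    unfolding refl_on_def Field_section[OF FG]
    using refl_face by (auto simp: poset_section_def Field_def)
  ultimately show "Partial_order (poset_section r F G)"
    unfolding partial_order_on_def preorder_on_def by (auto simp: Field_def)
  show "is_least_face (poset_section r F G) F"
    unfolding is_least_face_def Field_section[OF FG]
    using FG FG_Field refl_face by (auto simp: poset_section_def)
  show "is_greatest_face (poset_section r F G) G"
    unfolding is_greatest_face_def Field_section[OF FG]
    using FG FG_Field refl_face by (auto simp: poset_section_def)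
  show "rk H < rk K" if "(H, K) \<in> poset_section r F G" "H \<noteq> K" for H K
    using that rk_less by (auto simp: poset_section_def)
  show "\<exists>M. (H, M) \<in> poset_section r F G \<and> (M, K) \<in> poset_section r F G \<and> M \<noteq> H \<and> M \<noteq> K"
    if HK: "(H, K) \<in> poset_section r F G" "rk H + 1 < rk K" for H K
  proof -
    obtain M where "(H, M) \<in> r" "(M, K) \<in> r" "M \<noteq> H" "M \<noteq> K"
      using interpolate[of H K] HK by (auto simp: poset_section_def)
    then show ?thesis
      using HK trans_face unfolding poset_section_def by blast
  qed
qed

lemma face_rank_eq:
  assumes "F \<in> Field r"
  shows "face_rank r F = rk F - rk L - 1"
proof -
  have "(L, H) \<in> r" if "(H, F) \<in> r" for H
    using least that by (auto simp: is_least_face_def Field_def)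
  then have "{H. (H, F) \<in> r} = {H. (L, H) \<in> r \<and> (H, F) \<in> r}"
    by blast
  moreover have "(L, F) \<in> r"
    using assms least by (auto simp: is_least_face_def)
  ultimately show ?thesis
    unfolding face_rank_def
    using graded_poset.poset_rank_eq[OF graded_section] by (simp add: poset_section_def)
qed

lemma proper_faces_eq: "proper_faces r = Field r - {L, U}"
  using least greatest antisym_face
  unfolding proper_faces_def is_least_face_def is_greatest_face_def by blast

lemma proper_faces_section:
  assumes "(F, G) \<in> r"
  shows "proper_faces (poset_section r F G) = {H. (F, H) \<in> r \<and> (H, G) \<in> r \<and> H \<noteq> F \<and> H \<noteq> G}"
  using graded_poset.proper_faces_eq[OF graded_section[OF assms]] Field_section[OF assms] by auto

text \<open>Only sections of rank at least 2 need a connecting argument.\<close>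

lemma section_connectedI:
  assumes FG: "(F, G) \<in> r"
    and conn: "\<And>H K. rk F + 3 \<le> rk G \<Longrightarrow>
      H \<in> {H. (F, H) \<in> r \<and> (H, G) \<in> r \<and> H \<noteq> F \<and> H \<noteq> G} \<Longrightarrow>
      K \<in> {H. (F, H) \<in> r \<and> (H, G) \<in> r \<and> H \<noteq> F \<and> H \<noteq> G} \<Longrightarrow>
      (H, K) \<in> {(H, K). H \<in> {H. (F, H) \<in> r \<and> (H, G) \<in> r \<and> H \<noteq> F \<and> H \<noteq> G} \<and>
                        K \<in> {H. (F, H) \<in> r \<and> (H, G) \<in> r \<and> H \<noteq> F \<and> H \<noteq> G} \<and>
                        ((H, K) \<in> r \<or> (K, H) \<in> r)}\<^sup>*"
  shows "poset_connected (poset_section r F G)"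
proof (cases "rk F + 3 \<le> rk G")
  case False
  then show ?thesis
    using graded_poset.poset_rank_eq[OF graded_section[OF FG]] by (simp add: poset_connected_def)
next
  case True
  let ?Q = "{H. (F, H) \<in> r \<and> (H, G) \<in> r \<and> H \<noteq> F \<and> H \<noteq> G}"
  have "{(H, K). H \<in> ?Q \<and> K \<in> ?Q \<and> ((H, K) \<in> r \<or> (K, H) \<in> r)}
      = {(H, K). H \<in> ?Q \<and> K \<in> ?Q \<and>
          ((H, K) \<in> poset_section r F G \<or> (K, H) \<in> poset_section r F G)}"
    by (auto simp: poset_section_def)
  then show ?thesis
    using conn[OF True] unfolding poset_connected_def proper_faces_section[OF FG] by simp
qed

end


section \<open>Color components as faces\<close>

locale colored_graph =
  fixes n :: nat and R :: "'c set" and V :: "'v set" and E :: "'v set set" and \<kappa> :: "'v set \<Rightarrow> 'c"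
  assumes connected: "connected_graph V E"
    and regular: "properly_edge_colored_regular_graph n R V E \<kappa>"
begin

abbreviation comp :: "'c set \<Rightarrow> 'v \<Rightarrow> 'v set" where
  "comp C v \<equiv> color_equiv V E \<kappa> C `` {v}"

abbreviation P :: "('v, 'c) colorful_face rel" where
  "P \<equiv> colorful_polytope R V E \<kappa>"

text \<open>With -1 at the least face, the formula \<open>rk F - rk L - 1\<close> of graded posets
  returns \<open>rk F\<close>, so \<open>face_rank\<close> and \<open>rk\<close> agree without a
  shift.\<close>

definition rk :: "('v, 'c) colorful_face \<Rightarrow> int" where
  "rk F = (case F of None \<Rightarrow> -1 | Some (C, X) \<Rightarrow> int (card C))"

lemma rk_simps [simp]: "rk None = -1" "rk (Some (C, X)) = int (card C)"
  by (simp_all add: rk_def)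

lemma finite_R: "finite R" and card_R: "card R = n"
  using regular by (auto simp: properly_edge_colored_regular_graph_def)

lemma finite_colors: "C \<subseteq> R \<Longrightarrow> finite C"
  using finite_R finite_subset by blast

lemma edge_subset: "e \<in> E \<Longrightarrow> e \<subseteq> V" and edge_card: "e \<in> E \<Longrightarrow> card e = 2"
  and edge_color: "e \<in> E \<Longrightarrow> \<kappa> e \<in> R"
  using regular by (auto simp: properly_edge_colored_regular_graph_def)

lemma edge_unique: "e \<in> E \<Longrightarrow> e' \<in> E \<Longrightarrow> v \<in> e \<Longrightarrow> v \<in> e' \<Longrightarrow> \<kappa> e = \<kappa> e' \<Longrightarrow> e = e'"
  using regular unfolding properly_edge_colored_regular_graph_def by blast

text \<open>The \<open>n\<close> edges at \<open>v\<close> have different colors by properness, and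
  there are only \<open>n\<close> colors, so each color occurs.\<close>

lemma edge_exists:
  assumes "v \<in> V" "c \<in> R"
  obtains e where "e \<in> E" "v \<in> e" "\<kappa> e = c"
proof -
  let ?E = "{e \<in> E. v \<in> e}"
  have "inj_on \<kappa> ?E"
    using edge_unique by (auto intro: inj_onI)
  moreover have "finite ?E" "card ?E = n"
    using regular assms by (auto simp: properly_edge_colored_regular_graph_def)
  ultimately have "\<kappa> ` ?E = R"
    using edge_color finite_R card_R by (intro card_subset_eq) (auto simp: card_image)
  then show thesis
    using assms that by blast
qed

lemma edgeE:
  assumes "e \<in> E" "v \<in> e"
  obtains w where "e = {v, w}" "w \<noteq> v" "w \<in> V"
proof -
  obtain x y where "e = {x, y}" "x \<noteq> y"
    using edge_card[OF assms(1)] by (auto simp: card_2_iff)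
  then show thesis
    using assms edge_subset[OF assms(1)] that by auto
qed

section \<open>Color components and their inclusion order\<close>

lemma equiv_comp: "equiv V (color_equiv V E \<kappa> C)"
proof (rule equivI)
  let ?S = "{(x, y). {x, y} \<in> E \<and> \<kappa> {x, y} \<in> C}"
  have "sym ?S"
    by (auto simp: sym_def insert_commute)
  then have "sym (?S\<^sup>*)"
    by (rule sym_rtrancl)
  then show "sym (color_equiv V E \<kappa> C)"
    by (auto simp: color_equiv_def sym_def)
  show "trans (color_equiv V E \<kappa> C)"
    by (auto simp: color_equiv_def trans_def)
qed (auto simp: color_equiv_def refl_on_def)

lemma comp_subset: "comp C v \<subseteq> V"
  by (auto simp: color_equiv_def)

lemma comp_refl: "v \<in> V \<Longrightarrow> v \<in> comp C v"
  by (auto simp: color_equiv_def)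

lemma comp_eq: "w \<in> comp C v \<Longrightarrow> comp C w = comp C v"
  using equiv_class_eq[OF equiv_comp] by blast

lemma comp_mono: "C \<subseteq> D \<Longrightarrow> comp C v \<subseteq> comp D v"
proof -
  assume "C \<subseteq> D"
  then have "{(x, y). {x, y} \<in> E \<and> \<kappa> {x, y} \<in> C}\<^sup>* \<subseteq> {(x, y). {x, y} \<in> E \<and> \<kappa> {x, y} \<in> D}\<^sup>*"
    by (intro rtrancl_mono) auto
  then show ?thesis
    by (auto simp: color_equiv_def)
qed

lemma comp_empty: "v \<in> V \<Longrightarrow> comp {} v = {v}"
  by (auto simp: color_equiv_def)

lemma comp_R: "v \<in> V \<Longrightarrow> comp R v = V"
proof -
  have "{(x, y). {x, y} \<in> E \<and> \<kappa> {x, y} \<in> R} = {(x, y). {x, y} \<in> E}"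
    using edge_color by auto
  then show "v \<in> V \<Longrightarrow> comp R v = V"
    using connected by (auto simp: color_equiv_def connected_graph_def)
qed

text \<open>Properness leaves only \<open>e\<close> itself with its color at either end, so a walk
  in this color never leaves \<open>e\<close>.\<close>

lemma comp_single:
  assumes e: "e \<in> E" and v: "v \<in> e"
  shows "comp {\<kappa> e} v = e"
proof
  have eV: "e \<subseteq> V"
    using e by (rule edge_subset)
  have "w \<in> e" if "(v, w) \<in> {(x, y). {x, y} \<in> E \<and> \<kappa> {x, y} \<in> {\<kappa> e}}\<^sup>*" for w
    using that
  proof (induction rule: rtrancl_induct)
    case (step x y)
    then have "{x, y} = e"
      using edge_unique[of "{x, y}" e x] e by auto
    then show ?case
      by auto
  qed (rule v)
  then show "comp {\<kappa> e} v \<subseteq> e"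
    by (auto simp: color_equiv_def)
  show "e \<subseteq> comp {\<kappa> e} v"
  proof
    fix w assume "w \<in> e"
    obtain u where "e = {v, u}"
      using e v by (rule edgeE)
    with \<open>w \<in> e\<close> e eV show "w \<in> comp {\<kappa> e} v"
      by (cases "w = v") (auto simp: color_equiv_def)
  qed
qed

lemma Some_face: "Some (C, X) \<in> colorful_faces R V E \<kappa> \<longleftrightarrow> C \<subseteq> R \<and> (\<exists>v \<in> V. X = comp C v)"
  by (auto simp: colorful_faces_def quotient_def)

lemma None_face: "None \<in> colorful_faces R V E \<kappa>"
  by (simp add: colorful_faces_def)

lemma comp_face: "C \<subseteq> R \<Longrightarrow> v \<in> V \<Longrightarrow> Some (C, comp C v) \<in> colorful_faces R V E \<kappa>"
  by (auto simp: Some_face)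

lemma face_cases:
  assumes "F \<in> colorful_faces R V E \<kappa>"
  obtains (None) "F = None" | (Some) C v where "C \<subseteq> R" "v \<in> V" "F = Some (C, comp C v)"
  using assms by (cases F) (auto simp: Some_face)

lemma le_refl: "F \<in> colorful_faces R V E \<kappa> \<Longrightarrow> (F, F) \<in> P"
  by (cases F) (auto simp: colorful_polytope_def)

lemma Field_P: "Field P = colorful_faces R V E \<kappa>"
  using le_refl by (auto simp: Field_def colorful_polytope_def)

lemma None_le: "(None, F) \<in> P \<longleftrightarrow> F \<in> colorful_faces R V E \<kappa>"
  by (auto simp: colorful_polytope_def None_face)

lemma not_Some_le_None: "(Some (C, X), None) \<notin> P"
  by (auto simp: colorful_polytope_def)

text \<open>Components are monotone in the color set and do not depend on the base vertex, so
  comparability can be tested on one base vertex.\<close>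

lemma le_comp:
  assumes "C \<subseteq> R" "D \<subseteq> R" "v \<in> V" "w \<in> V"
  shows "(Some (C, comp C v), Some (D, comp D w)) \<in> P \<longleftrightarrow> C \<subseteq> D \<and> v \<in> comp D w"
proof
  assume "(Some (C, comp C v), Some (D, comp D w)) \<in> P"
  then have "C \<subseteq> D \<and> comp C v \<subseteq> comp D w"
    by (simp add: colorful_polytope_def)
  then show "C \<subseteq> D \<and> v \<in> comp D w"
    using comp_refl[OF assms(3)] by blast
next
  assume "C \<subseteq> D \<and> v \<in> comp D w"
  then have "C \<subseteq> D" "comp C v \<subseteq> comp D w"
    using comp_mono[of C D v] comp_eq[of v D w] by simp_all
  then show "(Some (C, comp C v), Some (D, comp D w)) \<in> P"
    using assms comp_face by (simp add: colorful_polytope_def)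
qed

lemma le_comp_same:
  assumes "C \<subseteq> D" "D \<subseteq> R" "v \<in> V"
  shows "(Some (C, comp C v), Some (D, comp D v)) \<in> P"
  using assms comp_refl[OF assms(3)] by (subst le_comp) auto

text \<open>A face above the component of \<open>v\<close> contains \<open>v\<close>, so it can be
  based at \<open>v\<close> and is determined by its color set. Chains, diamonds and vertex-figures
  above a vertex all reduce to sets of colors in this way.\<close>

lemma above_comp:
  assumes "(Some (C, comp C v), G) \<in> P" "v \<in> V"
  obtains D where "C \<subseteq> D" "D \<subseteq> R" "G = Some (D, comp D v)"
proof -
  have C: "C \<subseteq> R" and G: "G \<in> colorful_faces R V E \<kappa>"
    using assms(1) by (auto simp: colorful_polytope_def Some_face)
  from G show thesis
  proof (cases rule: face_cases)
    case None
    then show thesis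
      using assms not_Some_le_None by blast
  next
    case (Some D w)
    then have "C \<subseteq> D" "v \<in> comp D w"
      using assms le_comp[OF C Some(1) assms(2) Some(2)] by blast+
    then show thesis
      using that Some comp_eq[of v D w] by auto
  qed
qed

lemma graded: "\<exists>U. rk U = int n \<and> graded_poset P rk None U"
proof -
  obtain u where u: "u \<in> V"
    using connected by (auto simp: connected_graph_def)
  let ?U = "Some (R, comp R u)"
  have U: "?U \<in> colorful_faces R V E \<kappa>"
    using u by (simp add: comp_face)
  have "graded_poset P rk None ?U"
  proof
    have "trans P"
      unfolding trans_def
    proof (intro allI impI)
      fix F G H assume "(F, G) \<in> P" "(G, H) \<in> P"
      then show "(F, H) \<in> P"
        by (cases F; cases G; cases H) (auto simp: colorful_polytope_def, blast+)
    qed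
    moreover have "antisym P"
      unfolding antisym_def
    proof (intro allI impI)
      fix F G assume "(F, G) \<in> P" "(G, F) \<in> P"
      then show "F = G"
        by (cases F; cases G) (auto simp: colorful_polytope_def)
    qed
    ultimately show "Partial_order P"
      using le_refl unfolding partial_order_on_def preorder_on_def refl_on_def Field_P
      by (auto simp: colorful_polytope_def)
    show "is_least_face P None"
      by (simp add: is_least_face_def Field_P None_face None_le)
    show "is_greatest_face P ?U"
      unfolding is_greatest_face_def Field_P
    proof (intro conjI ballI U)
      fix G assume "G \<in> colorful_faces R V E \<kappa>"
      then show "(G, ?U) \<in> P"
      proof (cases rule: face_cases)
        case None
        then show ?thesis
          using U by (simp add: None_le)
      next
        case (Some C v)
        then show ?thesis
          using le_comp[of C R v u] comp_R u by simp
      qed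
    qed
    show "rk F < rk G" if FG: "(F, G) \<in> P" "F \<noteq> G" for F G
    proof -
      have "F \<in> colorful_faces R V E \<kappa>"
        using FG by (simp add: colorful_polytope_def)
      then show ?thesis
      proof (cases rule: face_cases)
        case None
        then show ?thesis
          using FG by (cases G) auto
      next
        case (Some C v)
        then obtain D where D: "C \<subseteq> D" "D \<subseteq> R" "G = Some (D, comp D v)"
          using FG above_comp[of C v G] by auto
        then have "C \<subset> D"
          using Some FG by auto
        then show ?thesis
          using D Some finite_colors psubset_card_mono[of D C] by auto
      qed
    qed
    show "\<exists>H. (F, H) \<in> P \<and> (H, G) \<in> P \<and> H \<noteq> F \<and> H \<noteq> G"
      if FG: "(F, G) \<in> P" "rk F + 1 < rk G" for F G
    proof -
      have F: "F \<in> colorful_faces R V E \<kappa>" and G: "G \<in> colorful_faces R V E \<kappa>"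
        using FG by (simp_all add: colorful_polytope_def)
      from F show ?thesis
      proof (cases rule: face_cases)
        case None
        from G show ?thesis
        proof (cases rule: face_cases)
          case (Some D w)
          then have "D \<noteq> {}"
            using FG None by auto
          \<comment> \<open>Between the least face and \<open>G\<close> lies the vertex
            \<open>w\<close>; the rank gap has excluded that \<open>G\<close> is a vertex
            itself.\<close>
          then show ?thesis
            using None Some le_comp_same[of "{}" D w] comp_face[of "{}" w]
            by (intro exI[of _ "Some ({}, comp {} w)"]) (auto simp: None_le)
        qed (use FG None in auto)
      next
        case (Some C v)
        then obtain D where D: "C \<subseteq> D" "D \<subseteq> R" "G = Some (D, comp D v)"
          using FG above_comp[of C v G] by auto
        then have "C \<noteq> D"
          using Some FG by auto
        then obtain c where c: "c \<in> D" "c \<notin> C"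
          using D by blast
        \<comment> \<open>One missing color \<open>c\<close> is added; the rank gap keeps the result
          different from \<open>D\<close>.\<close>
        have "card (insert c C) \<noteq> card D"
          using Some D FG c finite_colors by simp
        then show ?thesis
          using Some D c le_comp_same[of C "insert c C" v] le_comp_same[of "insert c C" D v]
          by (intro exI[of _ "Some (insert c C, comp (insert c C) v)"]) auto
      qed
    qed
  qed
  then show ?thesis
    by (intro exI[of _ ?U]) (simp add: card_R)
qed

lemma face_rank_P: "F \<in> Field P \<Longrightarrow> face_rank P F = rk F"
  using graded graded_poset.face_rank_eq by fastforce

lemma faces_of_rank_P: "faces_of_rank P j = {F \<in> colorful_faces R V E \<kappa>. rk F = j}"
  by (auto simp: faces_of_rank_def face_rank_P Field_P)

section \<open>Strong connectedness\<close>

text \<open>The section is the lattice of sets between \<open>C\<close> and \<open>B\<close>, with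
  at least three colors in \<open>B - C\<close>. From \<open>D\<close> the path goes down to
  \<open>C\<close> plus \<open>x\<close>, up to \<open>C\<close> plus \<open>x, y\<close>, down to
  \<open>C\<close> plus \<open>y\<close>, and up to \<open>D'\<close>.\<close>

lemma section_connected_Some:
  assumes v: "v \<in> V" and FG: "(Some (C, comp C v), G) \<in> P"
  shows "poset_connected (poset_section P (Some (C, comp C v)) G)"
proof -
  let ?F = "\<lambda>D. Some (D, comp D v)"
  obtain B where B: "C \<subseteq> B" "B \<subseteq> R" "G = ?F B"
    using FG v by (rule above_comp)
  obtain U where "graded_poset P rk None U"
    using graded by blast
  then show ?thesis
  proof (rule graded_poset.section_connectedI[OF _ FG])
    let ?Q = "{H. (?F C, H) \<in> P \<and> (H, G) \<in> P \<and> H \<noteq> ?F C \<and> H \<noteq> G}"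
    let ?S = "{(H, K). H \<in> ?Q \<and> K \<in> ?Q \<and> ((H, K) \<in> P \<or> (K, H) \<in> P)}"
    fix H K assume rk: "rk (?F C) + 3 \<le> rk G" and H: "H \<in> ?Q" and K: "K \<in> ?Q"
    have finB: "finite B"
      using B finite_colors by blast
    have 3: "card C + 3 \<le> card B"
      using rk B by simp
    obtain D where D: "C \<subseteq> D" "D \<subseteq> R" "H = ?F D"
      using H v above_comp[of C v H] by auto
    obtain D' where D': "C \<subseteq> D'" "D' \<subseteq> R" "K = ?F D'"
      using K v above_comp[of C v K] by auto
    have "D \<subseteq> B" "D' \<subseteq> B" "D \<noteq> C" "D' \<noteq> C" "D \<noteq> B" "D' \<noteq> B"
      using H K B D D' v by (auto simp: le_comp)
    then obtain x y where x: "x \<in> D" "x \<notin> C" and y: "y \<in> D'" "y \<notin> C"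
      using D D' by blast
    have Q: "?F A \<in> ?Q" if "C \<subseteq> A" "A \<subseteq> B" "A \<noteq> C" "A \<noteq> B" for A
      using that B le_comp_same[of C A v] le_comp_same[of A B v] v by auto
    \<comment> \<open>The rank bound \<open>card C + 3 \<le> card B\<close> is what keeps even the
      two-color set below the top.\<close>
    have xyB: "insert x (insert y C) \<noteq> B" "insert x C \<noteq> B" "insert y C \<noteq> B"
      using 3 finite_subset[OF B(1) finB] x y by (auto simp: card_insert_if split: if_splits)
    have S: "(M, N) \<in> ?S" if "M \<in> ?Q" "N \<in> ?Q" "(M, N) \<in> P \<or> (N, M) \<in> P" for M N
      using that by simp
    have comparable: "(?F A, ?F A') \<in> ?S"
      if A: "C \<subseteq> A" "A \<subseteq> B" "A \<noteq> C" "A \<noteq> B" and A': "C \<subseteq> A'" "A' \<subseteq> B" "A' \<noteq> C" "A' \<noteq> B"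
        and "A \<subseteq> A' \<or> A' \<subseteq> A" for A A'
    proof (rule S)
      show "?F A \<in> ?Q" "?F A' \<in> ?Q"
        using Q A A' by blast+
      have "A \<subseteq> R" "A' \<subseteq> R"
        using A A' B by blast+
      then show "(?F A, ?F A') \<in> P \<or> (?F A', ?F A) \<in> P"
        using that le_comp_same v by blast
    qed
    have "(H, ?F (insert x C)) \<in> ?S"
      unfolding D(3) using D x \<open>D \<subseteq> B\<close> \<open>D \<noteq> B\<close> xyB by (intro comparable) auto
    also have "(?F (insert x C), ?F (insert x (insert y C))) \<in> ?S"
      using B x y \<open>D \<subseteq> B\<close> \<open>D' \<subseteq> B\<close> xyB by (intro comparable) auto
    also have "(?F (insert x (insert y C)), ?F (insert y C)) \<in> ?S"
      using B x y \<open>D \<subseteq> B\<close> \<open>D' \<subseteq> B\<close> xyB by (intro comparable) auto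
    also have "(?F (insert y C), K) \<in> ?S"
      unfolding D'(3) using D' y \<open>D' \<subseteq> B\<close> \<open>D' \<noteq> B\<close> xyB by (intro comparable) auto
    finally show "(H, K) \<in> ?S\<^sup>*"
      by (rule trancl_into_rtrancl)
  qed
qed

text \<open>Every proper face contains a vertex, and the vertices of the component of
  \<open>G\<close> are joined by edges with colors in \<open>B\<close>. As \<open>B\<close> has at
  least two colors, these edges are themselves proper faces of the section.\<close>

lemma section_connected_None:
  assumes G: "(None, G) \<in> P"
  shows "poset_connected (poset_section P None G)"
proof -
  obtain U where "graded_poset P rk None U"
    using graded by blast
  then show ?thesis
  proof (rule graded_poset.section_connectedI[OF _ G])
    let ?Q = "{H. (None, H) \<in> P \<and> (H, G) \<in> P \<and> H \<noteq> None \<and> H \<noteq> G}"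
    let ?S = "{(H, K). H \<in> ?Q \<and> K \<in> ?Q \<and> ((H, K) \<in> P \<or> (K, H) \<in> P)}"
    let ?F = "\<lambda>u. Some ({} :: 'c set, comp {} u)"
    fix H K assume rk: "rk None + 3 \<le> rk G" and H: "H \<in> ?Q" and K: "K \<in> ?Q"
    have "G \<in> colorful_faces R V E \<kappa>"
      using G by (simp add: None_le)
    then obtain B w where B: "B \<subseteq> R" "w \<in> V" "G = Some (B, comp B w)"
      using rk by (cases rule: face_cases) auto
    have 2: "2 \<le> card B"
      using rk B by simp
    have Q: "Some (D, comp D u) \<in> ?Q" if "D \<subseteq> B" "u \<in> comp B w" "D \<noteq> B" for D u
    proof -
      have "u \<in> V" "D \<subseteq> R"
        using that comp_subset B by blast+
      then show ?thesis
        using that B by (auto simp: None_le comp_face le_comp)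
    qed
    have down: "\<exists>u \<in> comp B w. (K, ?F u) \<in> ?S \<and> (?F u, K) \<in> ?S" if K: "K \<in> ?Q" for K
    proof -
      have "K \<in> colorful_faces R V E \<kappa>"
        using K by (simp add: None_le)
      then obtain D u where D: "D \<subseteq> R" "u \<in> V" "K = Some (D, comp D u)"
        using K by (cases rule: face_cases) auto
      then have "D \<subseteq> B" "u \<in> comp B w"
        using K B by (auto simp: le_comp)
      moreover have "?F u \<in> ?Q"
        using \<open>u \<in> comp B w\<close> 2 by (intro Q) auto
      moreover have "(?F u, K) \<in> P"
        using D by (simp add: le_comp_same)
      ultimately show ?thesis
        using K by blast
    qed
    have vertices: "(?F u, ?F u') \<in> ?S\<^sup>*" if u: "u \<in> comp B w" "u' \<in> comp B w" for u u'
    proof -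
      have "u' \<in> comp B u"
        using u comp_eq by blast
      then have "(u, u') \<in> {(x, y). {x, y} \<in> E \<and> \<kappa> {x, y} \<in> B}\<^sup>*"
        by (auto simp: color_equiv_def)
      moreover have "u \<in> comp B u"
        using u comp_subset comp_refl by blast
      ultimately show ?thesis
      proof (induction rule: rtrancl_induct)
        case (step y z)
        let ?e = "{y, z}" and ?c = "\<kappa> {y, z}"
        \<comment> \<open>The edge \<open>{y, z}\<close> as a face; rewriting it as the component of
          \<open>z\<close> shows that it lies above both vertices.\<close>
        let ?K = "Some ({?c}, comp {?c} y)"
        have yz: "y \<in> V" "z \<in> V" "?e \<in> E" "?c \<in> B" "?c \<in> R"
          using step.hyps(2) edge_subset[of ?e] edge_color by auto
        have "y \<in> comp B u"
          using step.hyps(1) step.prems yz by (auto simp: color_equiv_def)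
        then have y: "y \<in> comp B w"
          using comp_eq u by blast
        have "z \<in> comp B y"
          using yz by (auto simp: color_equiv_def)
        then have z: "z \<in> comp B w"
          using comp_eq y by blast
        have "comp {?c} y = ?e"
          using yz by (intro comp_single) auto
        moreover have "comp {?c} z = ?e"
          using yz by (intro comp_single) auto
        ultimately have K: "?K = Some ({?c}, comp {?c} z)"
          by simp
        have "(?F y, ?K) \<in> P"
          using yz by (intro le_comp_same) auto
        moreover have "(?F z, ?K) \<in> P"
          unfolding K using yz by (intro le_comp_same) auto
        moreover have "?F y \<in> ?Q" "?F z \<in> ?Q"
          using y z 2 by (intro Q; fastforce)+
        moreover have "?K \<in> ?Q"
          using y yz 2 by (intro Q) auto
        ultimately have "(?F y, ?K) \<in> ?S" "(?K, ?F z) \<in> ?S"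
          by blast+
        then show ?case
          using step by (meson rtrancl.rtrancl_into_rtrancl)
      qed simp
    qed
    obtain u where "u \<in> comp B w" "(H, ?F u) \<in> ?S"
      using down[OF H] by blast
    moreover obtain u' where "u' \<in> comp B w" "(?F u', K) \<in> ?S"
      using down[OF K] by blast
    ultimately show "(H, K) \<in> ?S\<^sup>*"
      using vertices by (meson converse_rtrancl_into_rtrancl rtrancl.rtrancl_into_rtrancl)
  qed
qed

lemma section_connected: "(F, G) \<in> P \<Longrightarrow> poset_connected (poset_section P F G)"
proof -
  assume FG: "(F, G) \<in> P"
  then have "F \<in> colorful_faces R V E \<kappa>"
    by (simp add: colorful_polytope_def)
  then show ?thesis
    using FG section_connected_Some section_connected_None by (cases rule: face_cases) auto
qed

section \<open>Diamond condition, 1-skeleton and vertex-figures\<close>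

text \<open>Over the least face, \<open>G\<close> has one color and is an edge, so the faces between
  are its two ends. Otherwise \<open>B - C\<close> has two colors, and adding either one to
  \<open>C\<close> gives a face between.\<close>

lemma diamond:
  assumes F: "F \<in> faces_of_rank P (i - 1)" and G: "G \<in> faces_of_rank P (i + 1)" and FG: "(F, G) \<in> P"
  shows "card {H \<in> faces_of_rank P i. (F, H) \<in> P \<and> (H, G) \<in> P} = 2"
proof -
  have F': "F \<in> colorful_faces R V E \<kappa>" "rk F = i - 1"
    and G': "G \<in> colorful_faces R V E \<kappa>" "rk G = i + 1"
    using F G by (simp_all add: faces_of_rank_P)
  from F'(1) show ?thesis
  proof (cases rule: face_cases)
    case None
    then have i: "i = 0"
      using F' by simp
    then obtain B w where B: "B \<subseteq> R" "w \<in> V" "G = Some (B, comp B w)"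
      using G' by (auto elim!: face_cases)
    then obtain c where c: "B = {c}" "c \<in> R"
      using G' i by (auto simp: card_1_singleton_iff)
    obtain e where e: "e \<in> E" "w \<in> e" "\<kappa> e = c"
      using edge_exists B c by blast
    have comp_e: "comp B w = e"
      using comp_single e c by blast
    let ?F = "\<lambda>u. Some ({} :: 'c set, comp {} u)"
    have eq: "{H \<in> faces_of_rank P i. (F, H) \<in> P \<and> (H, G) \<in> P} = ?F ` e"
    proof (intro set_eqI iffI)
      fix H assume "H \<in> {H \<in> faces_of_rank P i. (F, H) \<in> P \<and> (H, G) \<in> P}"
      then have H: "H \<in> colorful_faces R V E \<kappa>" "rk H = 0" "(H, G) \<in> P"
        by (auto simp: faces_of_rank_P i)
      from H(1) show "H \<in> ?F ` e"
      proof (cases rule: face_cases)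
        case (Some C v)
        then have "C = {}" "v \<in> e"
          using H B comp_e finite_colors by (auto simp: le_comp)
        then show ?thesis
          using Some by blast
      qed (use H in auto)
    next
      fix H :: "('v, 'c) colorful_face"
      assume "H \<in> ?F ` e"
      then obtain v where v: "v \<in> e" "H = ?F v"
        by blast
      then have "v \<in> V"
        using e edge_subset by blast
      then show "H \<in> {H \<in> faces_of_rank P i. (F, H) \<in> P \<and> (H, G) \<in> P}"
        using v None B comp_e by (auto simp: faces_of_rank_P i comp_face None_le le_comp)
    qed
    have inj: "inj_on ?F e"
    proof (rule inj_onI)
      fix u v assume "u \<in> e" "v \<in> e" "?F u = ?F v"
      then show "u = v"
        using comp_empty[of u] comp_empty[of v] edge_subset[OF e(1)] by auto
    qed
    show ?thesis
      unfolding eq card_image[OF inj] by (rule edge_card[OF e(1)])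
  next
    case (Some C v)
    have "(Some (C, comp C v), G) \<in> P"
      using FG Some(3) by simp
    then obtain B where B: "C \<subseteq> B" "B \<subseteq> R" "G = Some (B, comp B v)"
      using Some(2) by (rule above_comp)
    let ?F = "\<lambda>c. Some (insert c C, comp (insert c C) v)"
    have finC: "finite C"
      using Some finite_colors by blast
    have card: "int (card C) = i - 1" "int (card B) = i + 1"
      using F' G' Some B by simp_all
    have "{H \<in> faces_of_rank P i. (F, H) \<in> P \<and> (H, G) \<in> P} = ?F ` (B - C)"
    proof (intro set_eqI iffI)
      fix H assume "H \<in> {H \<in> faces_of_rank P i. (F, H) \<in> P \<and> (H, G) \<in> P}"
      then have H: "rk H = i" "(F, H) \<in> P" "(H, G) \<in> P"
        by (auto simp: faces_of_rank_P)
      obtain D where D: "C \<subseteq> D" "D \<subseteq> R" "H = Some (D, comp D v)"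
        using H(2) above_comp[of C v H] Some by blast
      then have "D \<subseteq> B"
        using H B Some by (auto simp: le_comp)
      have "card (D - C) = 1"
        using D H card finC by (simp add: card_Diff_subset)
      then obtain c where "D - C = {c}"
        by (auto simp: card_1_singleton_iff)
      then have "D = insert c C" "c \<in> B - C"
        using D \<open>D \<subseteq> B\<close> by blast+
      then show "H \<in> ?F ` (B - C)"
        using D by blast
    next
      fix H :: "('v, 'c) colorful_face"
      assume "H \<in> ?F ` (B - C)"
      then obtain c where c: "c \<in> B" "c \<notin> C" "H = ?F c"
        by blast
      then have "insert c C \<subseteq> B"
        using B by blast
      then show "H \<in> {H \<in> faces_of_rank P i. (F, H) \<in> P \<and> (H, G) \<in> P}"
        using c Some B card finC le_comp_same[of C "insert c C" v] le_comp_same[of "insert c C" B v]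
          comp_face[of "insert c C" v]
        by (auto simp: faces_of_rank_P)
    qed
    moreover have "inj_on ?F (B - C)"
      by (rule inj_onI) auto
    moreover have "card (B - C) = 2"
      using card B finC by (simp add: card_Diff_subset)
    ultimately show ?thesis
      by (simp add: card_image)
  qed
qed

lemma abstract_polytope_P: "abstract_polytope (int n) P"
proof -
  obtain U where U: "rk U = int n" "graded_poset P rk None U"
    using graded by blast
  interpret graded_poset P rk None U
    by (rule U)
  show ?thesis
    unfolding abstract_polytope_def
    using partial_order least greatest flags_of_rank_iff U(1) section_connected diamond by auto
qed

lemma vertices_P: "faces_of_rank P 0 = (\<lambda>v. Some ({}, {v})) ` V"
proof (intro set_eqI iffI)
  fix F assume "F \<in> faces_of_rank P 0"
  then have F: "F \<in> colorful_faces R V E \<kappa>" "rk F = 0"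
    by (auto simp: faces_of_rank_P)
  from F(1) show "F \<in> (\<lambda>v. Some ({}, {v})) ` V"
    by (cases rule: face_cases) (use F(2) in \<open>auto simp: finite_colors comp_empty\<close>)
next
  fix F :: "('v, 'c) colorful_face"
  assume "F \<in> (\<lambda>v. Some ({}, {v})) ` V"
  then show "F \<in> faces_of_rank P 0"
    using comp_face[of "{}"] comp_empty by (auto simp: faces_of_rank_P)
qed

text \<open>Every vertex meets an edge of each color, so a component for a single color is never an
  isolated vertex but exactly one edge.\<close>

lemma edges_P: "faces_of_rank P 1 = (\<lambda>e. Some ({\<kappa> e}, e)) ` E"
proof (intro set_eqI iffI)
  fix F assume "F \<in> faces_of_rank P 1"
  then have F: "F \<in> colorful_faces R V E \<kappa>" "rk F = 1"
    by (auto simp: faces_of_rank_P)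
  from F(1) show "F \<in> (\<lambda>e. Some ({\<kappa> e}, e)) ` E"
  proof (cases rule: face_cases)
    case (Some C v)
    then obtain c where "C = {c}" "c \<in> R"
      using F by (auto simp: card_1_singleton_iff)
    moreover obtain e where "e \<in> E" "v \<in> e" "\<kappa> e = c"
      using edge_exists Some calculation by blast
    ultimately show ?thesis
      using Some comp_single by blast
  qed (use F in auto)
next
  fix F assume "F \<in> (\<lambda>e. Some ({\<kappa> e}, e)) ` E"
  then obtain e where e: "e \<in> E" "F = Some ({\<kappa> e}, e)"
    by blast
  obtain v where "v \<in> e"
    using edge_card[OF e(1)] by fastforce
  then have "e = comp {\<kappa> e} v" "v \<in> V"
    using comp_single e edge_subset by blast+
  then show "F \<in> faces_of_rank P 1"
    using e comp_face[of "{\<kappa> e}" v] edge_color[OF e(1)] by (simp add: faces_of_rank_P)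
qed

lemma one_skeleton_P: "is_one_skeleton V E P"
  unfolding is_one_skeleton_def
proof (intro exI conjI ballI)
  show "bij_betw (\<lambda>v. Some ({}, {v})) V (faces_of_rank P 0)"
    unfolding vertices_P by (auto intro: inj_onI simp: bij_betw_def)
  show "bij_betw (\<lambda>e. Some ({\<kappa> e}, e)) E (faces_of_rank P 1)"
    unfolding edges_P by (auto intro: inj_onI simp: bij_betw_def)
  fix v e assume "v \<in> V" "e \<in> E"
  then have "Some ({}, {v}) \<in> faces_of_rank P 0" "Some ({\<kappa> e}, e) \<in> faces_of_rank P 1"
    unfolding vertices_P edges_P by blast+
  then have "Some ({}, {v}) \<in> colorful_faces R V E \<kappa>" "Some ({\<kappa> e}, e) \<in> colorful_faces R V E \<kappa>"
    unfolding faces_of_rank_P by blast+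
  then show "v \<in> e \<longleftrightarrow> (Some ({}, {v}), Some ({\<kappa> e}, e)) \<in> P"
    by (simp add: colorful_polytope_def)
qed

text \<open>Faces above a vertex correspond to the subsets of \<open>R\<close>, ordered by
  inclusion; a numbering \<open>h\<close> of the colors carries them to the faces of the simplex on
  \<open>n\<close> points.\<close>

lemma vertex_figure_P:
  assumes "F \<in> faces_of_rank P 0"
  shows "poset_isomorphic (vertex_figure P F) (simplex_poset (int n - 1))"
proof -
  obtain v where v: "v \<in> V" "F = Some ({}, comp {} v)"
    using assms comp_empty by (auto simp: vertices_P)
  obtain h where h: "bij_betw h R {..<n}"
    using ex_bij_betw_finite_nat[OF finite_R] card_R by (auto simp: atLeast0LessThan)
  let ?F = "\<lambda>C. Some (C, comp C v)"
  have iff: "(F, H) \<in> P \<longleftrightarrow> H \<in> ?F ` Pow R" for H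
  proof
    assume "(F, H) \<in> P"
    then show "H \<in> ?F ` Pow R"
      using v above_comp[of "{}" v H] by auto
  next
    assume "H \<in> ?F ` Pow R"
    then show "(F, H) \<in> P"
      using v le_comp_same by auto
  qed
  have mem: "(?F C, ?F D) \<in> vertex_figure P F \<longleftrightarrow> C \<subseteq> D" if "C \<subseteq> R" "D \<subseteq> R" for C D
    using that v comp_refl[OF v(1)] by (auto simp: vertex_figure_def iff le_comp)
  have Field1: "Field (vertex_figure P F) = ?F ` Pow R"
  proof
    show "Field (vertex_figure P F) \<subseteq> ?F ` Pow R"
      by (auto simp: vertex_figure_def Field_def iff)
    show "?F ` Pow R \<subseteq> Field (vertex_figure P F)"
      using mem by (auto intro: FieldI1[OF iffD2[OF mem]])
  qed
  have Field2: "Field (simplex_poset (int n - 1)) = Pow {..<n}"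
    by (auto simp: simplex_poset_def Field_def)
  \<comment> \<open>The value at \<open>None\<close> is a dummy, as the least face is not above a
    vertex.\<close>
  let ?f = "\<lambda>H. case H of Some (C, X) \<Rightarrow> h ` C | None \<Rightarrow> {}"
  have "bij_betw (?f \<circ> ?F) (Pow R) (Pow {..<n})"
    using bij_betw_Pow[OF h] by (simp add: comp_def)
  moreover have "bij_betw ?F (Pow R) (?F ` Pow R)"
    by (auto simp: bij_betw_def intro: inj_onI)
  ultimately have "bij_betw ?f (?F ` Pow R) (Pow {..<n})"
    by (simp add: bij_betw_comp_iff)
  moreover have "(x, y) \<in> vertex_figure P F \<longleftrightarrow> (?f x, ?f y) \<in> simplex_poset (int n - 1)"
    if xy: "x \<in> ?F ` Pow R" "y \<in> ?F ` Pow R" for x y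
  proof -
    obtain C D where CD: "x = ?F C" "y = ?F D" "C \<subseteq> R" "D \<subseteq> R"
      using xy by blast
    then have "h ` D \<subseteq> {i. int i \<le> int n - 1}"
      using h by (auto simp: bij_betw_def)
    moreover have "h ` C \<subseteq> h ` D \<longleftrightarrow> C \<subseteq> D"
    proof
      assume "h ` C \<subseteq> h ` D"
      then show "C \<subseteq> D"
        using CD h unfolding bij_betw_def inj_on_def by blast
    qed (rule image_mono)
    ultimately show ?thesis
      using CD mem by (auto simp: simplex_poset_def)
  qed
  ultimately show ?thesis
    unfolding poset_isomorphic_def Field1 Field2 by blast
qed

lemma simple_abstract_polytope_P: "simple_abstract_polytope (int n) P"
  by (simp add: simple_abstract_polytope_def abstract_polytope_P vertex_figure_P)

end


section \<open>Flips of triangulations\<close>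

lemma doubleton_less_iff: "i < j \<Longrightarrow> k < l \<Longrightarrow> {i, j} = {k, l} \<longleftrightarrow> k = i \<and> l = j"
  for i j k l :: nat
  by (auto simp: doubleton_eq_iff)

lemma sides_iff:
  "i < j \<Longrightarrow> {i, j} \<in> polygon_sides n \<longleftrightarrow> 1 \<le> i \<and> j \<le> n + 3 \<and> (j = i + 1 \<or> i = 1 \<and> j = n + 3)"
  by (auto simp: polygon_sides_def doubleton_eq_iff)

lemma diagonals_iff:
  assumes "i < j"
  shows "{i, j} \<in> diagonals n \<longleftrightarrow> 1 \<le> i \<and> i + 2 \<le> j \<and> j \<le> n + 3 \<and> \<not> (i = 1 \<and> j = n + 3)"
proof -
  have "{i, j} \<in> {{i, j} | i j. i \<in> {1..n + 3} \<and> j \<in> {1..n + 3} \<and> i \<noteq> j} \<longleftrightarrow> 1 \<le> i \<and> j \<le> n + 3"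
    using assms by (fastforce simp: doubleton_eq_iff)
  then show ?thesis
    using assms unfolding diagonals_def Diff_iff sides_iff[OF assms] by auto
qed

lemma diagonalE:
  assumes "d \<in> diagonals n"
  obtains i j where "d = {i, j}" "i < j"
proof -
  obtain i j where "d = {i, j}" "i \<noteq> j"
    using assms by (auto simp: diagonals_def)
  then show thesis
    using that[of i j] that[of j i] by (cases "i < j") auto
qed

lemma crosses_iff:
  assumes "i < j" "k < l"
  shows "crosses {i, j} {k, l} \<longleftrightarrow> i < k \<and> k < j \<and> j < l \<or> k < i \<and> i < l \<and> l < j"
proof
  assume "crosses {i, j} {k, l}"
  then obtain a b c f where "a < b" "b < c" "c < f"
    "{i, j} = {a, c} \<and> {k, l} = {b, f} \<or> {i, j} = {b, f} \<and> {k, l} = {a, c}"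
    unfolding crosses_def by blast
  then show "i < k \<and> k < j \<and> j < l \<or> k < i \<and> i < l \<and> l < j"
    using assms by (auto simp: doubleton_eq_iff)
qed (unfold crosses_def, blast)

text \<open>Sides are included so that the two legs of a triangle are again segments, which permits
  recursion. The order \<open>i < j\<close> distinguishes an inner side, with vertices strictly
  between \<open>i\<close> and \<open>j\<close>, from an outer one.\<close>

definition seg :: "nat \<Rightarrow> nat set set \<Rightarrow> nat \<Rightarrow> nat \<Rightarrow> bool" where
  "seg n T i j \<longleftrightarrow> i < j \<and> {i, j} \<in> polygon_sides n \<union> T"

lemma seg_less: "seg n T i j \<Longrightarrow> i < j"
  by (simp add: seg_def)

lemma seg_side: "1 \<le> i \<Longrightarrow> i < n + 3 \<Longrightarrow> seg n T i (i + 1)"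
  by (simp add: seg_def sides_iff)

lemma seg_root: "seg n T 1 (n + 3)"
  by (simp add: seg_def sides_iff)

lemma seg_bounds: "noncrossing n T \<Longrightarrow> seg n T i j \<Longrightarrow> 1 \<le> i \<and> i < j \<and> j \<le> n + 3"
  by (auto simp: seg_def sides_iff noncrossing_def dest!: subsetD simp: diagonals_iff)

text \<open>The endpoints of a side alternate with no other pair of vertices, so both segments are
  diagonals in \<open>T\<close>.\<close>

lemma seg_noncrossing:
  assumes "noncrossing n T" "seg n T i j" "seg n T k l" "i < k" "k < j" "j < l"
  shows False
proof -
  have "1 \<le> i" "j \<le> n + 3" "1 \<le> k" "l \<le> n + 3"
    using assms seg_bounds by blast+
  then have "{i, j} \<in> T" "{k, l} \<in> T"
    using assms by (auto simp: seg_def sides_iff)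
  moreover have "crosses {i, j} {k, l}"
    using assms by (simp add: crosses_iff)
  ultimately show False
    using assms(1) by (auto simp: noncrossing_def)
qed

lemma finite_diagonals: "finite (diagonals n)"
proof (rule finite_subset)
  show "diagonals n \<subseteq> Pow {1..n + 3}"
    by (auto simp: diagonals_def)
qed simp

lemma noncrossing_finite: "noncrossing n T \<Longrightarrow> finite T"
  using finite_diagonals finite_subset by (auto simp: noncrossing_def)

lemma triangulation_noncrossing: "triangulation n T \<Longrightarrow> noncrossing n T"
  by (simp add: triangulation_def)

lemma triangulation_finite: "triangulation n T \<Longrightarrow> finite T"
  using noncrossing_finite triangulation_noncrossing by blast

lemma crosses_sym: "crosses d e \<Longrightarrow> crosses e d"
  unfolding crosses_def by blast

lemma not_crosses_self: "i < j \<Longrightarrow> \<not> crosses {i, j} {i, j}"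
  by (simp add: crosses_iff)

lemma noncrossing_insert:
  assumes "noncrossing n T" "d \<in> diagonals n" "\<And>e. e \<in> T \<Longrightarrow> \<not> crosses d e"
  shows "noncrossing n (insert d T)"
proof -
  have "\<not> crosses d d"
    using assms(2) not_crosses_self by (metis diagonalE)
  then show ?thesis
    using assms crosses_sym unfolding noncrossing_def by blast
qed

lemma noncrossing_subset: "noncrossing n T \<Longrightarrow> S \<subseteq> T \<Longrightarrow> noncrossing n S"
  unfolding noncrossing_def by blast

text \<open>A diagonal crossing nothing in \<open>T\<close> could be added to \<open>T\<close>,
  against maximality; a pair of vertices that is not a diagonal is a side.\<close>

lemma triangulation_seg:
  assumes T: "triangulation n T" and ij: "1 \<le> i" "i < j" "j \<le> n + 3"
    and nc: "\<And>k l. seg n T k l \<Longrightarrow> \<not> (i < k \<and> k < j \<and> j < l) \<and> \<not> (k < i \<and> i < l \<and> l < j)"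
  shows "seg n T i j"
proof (cases "{i, j} \<in> diagonals n")
  case True
  have "\<not> crosses {i, j} e" if e: "e \<in> T" for e
  proof -
    have "e \<in> diagonals n"
      using T e by (auto simp: triangulation_def noncrossing_def)
    then obtain k l where "e = {k, l}" "k < l"
      by (rule diagonalE)
    then show ?thesis
      using e nc[of k l] ij by (auto simp: seg_def crosses_iff)
  qed
  then have "noncrossing n (insert {i, j} T)"
    using T True noncrossing_insert triangulation_noncrossing by blast
  then have "{i, j} \<in> T"
    using T unfolding triangulation_def by blast
  then show ?thesis
    using ij by (simp add: seg_def)
next
  case False
  then show ?thesis
    using ij by (auto simp: seg_def diagonals_iff sides_iff)
qed

section \<open>Triangles on both sides of a segment\<close>

text \<open>The apex is the farthest neighbor \<open>b\<close> of \<open>i\<close> before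
  \<open>j\<close>. A segment crossing \<open>(b, j)\<close> would cross \<open>(i, j)\<close> or
  \<open>(i, b)\<close>, or would lead to a farther neighbor of \<open>i\<close>.\<close>

lemma apex_exists:
  assumes T: "triangulation n T" and ij: "seg n T i j" "i + 2 \<le> j"
  obtains b where "seg n T i b" "seg n T b j"
proof -
  have nc: "noncrossing n T"
    using T by (rule triangulation_noncrossing)
  have bounds: "1 \<le> i" "j \<le> n + 3"
    using seg_bounds[OF nc ij(1)] by auto
  let ?B = "\<lambda>b. seg n T i b \<and> b < j"
  have "?B (i + 1)"
    using bounds ij seg_side by simp
  then obtain b where b: "?B b" "\<And>b'. ?B b' \<Longrightarrow> b' \<le> b"
    using ex_has_greatest_nat[of ?B "i + 1" "\<lambda>x. x" j] by fastforce
  have "i < b"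
    using b seg_less by blast
  have "seg n T b j"
  proof (rule triangulation_seg[OF T])
    fix k l assume kl: "seg n T k l"
    show "\<not> (b < k \<and> k < j \<and> j < l) \<and> \<not> (k < b \<and> b < l \<and> l < j)"
    proof (intro conjI notI)
      assume "b < k \<and> k < j \<and> j < l"
      then show False
        using seg_noncrossing[OF nc ij(1) kl] \<open>i < b\<close> by simp
    next
      assume c: "k < b \<and> b < l \<and> l < j"
      consider "k < i" | "k = i" | "i < k"
        by linarith
      then show False
      proof cases
        case 1
        then show False
          using seg_noncrossing[OF nc kl ij(1)] c \<open>i < b\<close> by simp
      next
        case 2
        then show False
          using b(2)[of l] kl c by simp
      next
        case 3
        then show False
          using seg_noncrossing[OF nc _ kl] b(1) c by blast
      qed
    qed
  qed (use b bounds \<open>i < b\<close> in auto)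
  then show thesis
    using that b by blast
qed

text \<open>Let \<open>(x, y)\<close> be a shortest segment properly containing
  \<open>(i, j)\<close>. Its apex \<open>b\<close> is not strictly inside \<open>(i, j)\<close>,
  since a leg would cross \<open>(i, j)\<close>. So one leg contains \<open>(i, j)\<close> and
  equals it by minimality; the end of \<open>(x, y)\<close> off that leg is the outer apex.\<close>

lemma outer_apex_exists:
  assumes T: "triangulation n T" and ij: "seg n T i j" "(i, j) \<noteq> (1, n + 3)"
  obtains f where "seg n T f i" "seg n T f j" | f where "seg n T i f" "seg n T j f"
proof -
  have nc: "noncrossing n T"
    using T by (rule triangulation_noncrossing)
  have bounds: "1 \<le> i" "i < j" "j \<le> n + 3"
    using seg_bounds[OF nc ij(1)] by auto
  let ?P = "\<lambda>(x, y). seg n T x y \<and> x \<le> i \<and> j \<le> y \<and> (x, y) \<noteq> (i, j)"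
  have "?P (1, n + 3)"
    using ij bounds seg_root by auto
  then obtain z where z: "?P z" "\<And>w. ?P w \<Longrightarrow> snd z - fst z \<le> snd w - fst w"
    using ex_has_least_nat[of ?P "(1, n + 3)" "\<lambda>z. snd z - fst z"] by blast
  obtain x y where "z = (x, y)"
    by fastforce
  then have xy: "?P (x, y)" and least: "\<And>x' y'. ?P (x', y') \<Longrightarrow> y - x \<le> y' - x'"
    using z(1) z(2)[of "(x', y')" for x' y'] by auto
  have seg_xy: "seg n T x y" and le: "x \<le> i" "j \<le> y" and ne: "x \<noteq> i \<or> y \<noteq> j"
    using xy by auto
  obtain b where b: "seg n T x b" "seg n T b y"
  proof (rule apex_exists[OF T seg_xy])
    show "x + 2 \<le> y"
      using le ne bounds by linarith
  qed
  have xby: "x < b" "b < y"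
    using b seg_less by blast+
  consider "b \<le> i" | "i < b" "b < j" | "j \<le> b"
    by linarith
  then show thesis
  proof cases
    case 1
    have "(b, y) = (i, j)"
    proof (rule ccontr)
      assume "(b, y) \<noteq> (i, j)"
      then have "y - x \<le> y - b"
        using least[of b y] b le 1 by auto
      then show False
        using xby by simp
    qed
    then show thesis
      using that(1)[of x] b seg_xy by simp
  next
    case 2
    then have "\<not> x < i" "\<not> j < y"
      using seg_noncrossing[OF nc b(1) ij(1)] seg_noncrossing[OF nc ij(1) b(2)] by auto
    then show thesis
      using le ne by auto
  next
    case 3
    have "(x, b) = (i, j)"
    proof (rule ccontr)
      assume "(x, b) \<noteq> (i, j)"
      then have "y - x \<le> b - x"
        using least[of x b] b le 3 by auto
      then show False
        using xby by simp
    qed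
    then show thesis
      using that(2)[of y] b seg_xy by simp
  qed
qed

section \<open>The number of diagonals\<close>

text \<open>Splitting at apexes gives a full binary tree with the \<open>j - i\<close> unit sides as
  leaves, hence \<open>2 * (j - i) - 1\<close> nodes.\<close>

lemma card_segs:
  assumes T: "triangulation n T" and ij: "seg n T i j"
  shows "card {(k, l). seg n T k l \<and> i \<le> k \<and> l \<le> j} = 2 * (j - i) - 1"
  using ij
proof (induction "j - i" arbitrary: i j rule: less_induct)
  case less
  let ?N = "\<lambda>i j. {(k, l). seg n T k l \<and> i \<le> k \<and> l \<le> j}"
  have nc: "noncrossing n T"
    using T by (rule triangulation_noncrossing)
  have fin: "finite (?N i j)" for i j
    by (rule finite_subset[of _ "{i..j} \<times> {i..j}"]) (auto dest: seg_less)
  have "i < j"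
    using less.prems seg_less by blast
  show ?case
  proof (cases "i + 2 \<le> j")
    case False
    then have "j = Suc i"
      using \<open>i < j\<close> by simp
    then have "?N i j = {(i, j)}"
      using less.prems by (auto dest: seg_less)
    then show ?thesis
      using \<open>j = Suc i\<close> by simp
  next
    case True
    then obtain b where b: "seg n T i b" "seg n T b j"
      using apex_exists[OF T less.prems] by blast
    have ibj: "i < b" "b < j"
      using b seg_less by blast+
    \<comment> \<open>A segment straddling \<open>b\<close> other than \<open>(i, j)\<close> would
      cross one of the two legs.\<close>
    have "?N i j = insert (i, j) (?N i b \<union> ?N b j)"
    proof (intro set_eqI iffI)
      fix e assume "e \<in> ?N i j"
      then obtain k l where e: "e = (k, l)" and kl: "seg n T k l" "i \<le> k" "l \<le> j"
        by blast
      then have "\<not> (i < k \<and> k < b \<and> b < l)" "\<not> (k < b \<and> b < l \<and> l < j)"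
        using seg_noncrossing[OF nc b(1) kl(1)] seg_noncrossing[OF nc kl(1) b(2)] by blast+
      then show "e \<in> insert (i, j) (?N i b \<union> ?N b j)"
        using e kl seg_less[OF kl(1)] by auto
    next
      fix e assume "e \<in> insert (i, j) (?N i b \<union> ?N b j)"
      then show "e \<in> ?N i j"
        using less.prems ibj by auto
    qed
    moreover have "?N i b \<inter> ?N b j = {}"
      by (auto dest: seg_less)
    moreover have "(i, j) \<notin> ?N i b \<union> ?N b j"
      using ibj by auto
    moreover have "card (?N i b) = 2 * (b - i) - 1" "card (?N b j) = 2 * (j - b) - 1"
      using less.hyps[OF _ b(1)] less.hyps[OF _ b(2)] ibj by auto
    ultimately have "card (?N i j) = Suc ((2 * (b - i) - 1) + (2 * (j - b) - 1))"
      using fin by (simp add: card_Un_disjoint)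
    then show ?thesis
      using ibj by simp
  qed
qed

lemma triangulation_card:
  assumes T: "triangulation n T"
  shows "card T = n"
proof -
  have nc: "noncrossing n T"
    using T by (rule triangulation_noncrossing)
  let ?N = "{(k, l). seg n T k l \<and> 1 \<le> k \<and> l \<le> n + 3}"
  let ?S = "insert (1, n + 3) ((\<lambda>i. (i, i + 1)) ` {1..n + 2})"
  let ?D = "{(k, l). k < l \<and> {k, l} \<in> T}"
  have T_diag: "T \<subseteq> diagonals n"
    using nc by (simp add: noncrossing_def)
  have N: "?N = ?S \<union> ?D"
  proof (intro set_eqI iffI)
    fix e assume "e \<in> ?N"
    then obtain k l where "e = (k, l)" "k < l" "{k, l} \<in> polygon_sides n \<or> {k, l} \<in> T"
      by (auto simp: seg_def)
    then show "e \<in> ?S \<union> ?D"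
      by (auto simp: sides_iff)
  next
    fix e assume "e \<in> ?S \<union> ?D"
    then obtain k l where kl: "e = (k, l)" "seg n T k l"
      using seg_root[of n T] seg_side[of _ n T] by (auto simp: seg_def)
    then show "e \<in> ?N"
      using seg_bounds[OF nc kl(2)] by simp
  qed
  have disj: "?S \<inter> ?D = {}"
    using T_diag diagonals_iff[of 1 "n + 3" n] diagonals_iff[of i "i + 1" n for i] by auto
  have inj: "inj_on (\<lambda>(k, l). {k, l}) ?D"
    by (auto simp: inj_on_def doubleton_eq_iff)
  have image: "(\<lambda>(k, l). {k, l}) ` ?D = T"
  proof
    show "T \<subseteq> (\<lambda>(k, l). {k, l}) ` ?D"
    proof
      fix d assume d: "d \<in> T"
      then obtain i j where "d = {i, j}" "i < j"
        using T_diag diagonalE by blast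
      then show "d \<in> (\<lambda>(k, l). {k, l}) ` ?D"
        using d by force
    qed
  qed auto
  then have cardD: "card ?D = card T"
    using card_image[OF inj] by simp
  have "finite ?D"
    by (rule finite_imageD[OF _ inj]) (simp only: image noncrossing_finite[OF nc])
  moreover have "card ?S = n + 3"
    by (subst card_insert_disjoint) (auto simp: card_image inj_on_def)
  ultimately have "card ?N = n + 3 + card T"
    unfolding N using disj cardD by (subst card_Un_disjoint) auto
  \<comment> \<open>The root \<open>(1, n + 3)\<close> spans \<open>n + 2\<close> unit sides, so
    there are \<open>2 * (n + 2) - 1\<close> segments, \<open>n + 3\<close> of them sides.\<close>
  moreover have "card ?N = 2 * n + 3"
    using card_segs[OF T seg_root] by simp
  ultimately show ?thesis
    by simp
qed

lemma noncrossing_extend: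
  assumes "noncrossing n T"
  obtains T' where "T \<subseteq> T'" "triangulation n T'"
proof -
  let ?P = "\<lambda>S. noncrossing n S \<and> T \<subseteq> S"
  have "card S \<le> card (diagonals n)" if "?P S" for S
    using that finite_diagonals by (auto simp: noncrossing_def intro: card_mono)
  then obtain S where S: "?P S" "\<And>S'. ?P S' \<Longrightarrow> card S' \<le> card S"
    using ex_has_greatest_nat[of ?P T card "Suc (card (diagonals n))"] assms le_imp_less_Suc by blast
  have "S' = S" if "noncrossing n S'" "S \<subseteq> S'" for S'
    using card_seteq[OF noncrossing_finite[OF that(1)] that(2)] S that by auto
  then show thesis
    using that S by (auto simp: triangulation_def)
qed

text \<open>A noncrossing set of \<open>n\<close> diagonals extends to a triangulation, which has
  \<open>n\<close> elements too, so nothing was added. After a flip, a count thus replaces the check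
  of maximality.\<close>

lemma triangulation_iff_card: "triangulation n T \<longleftrightarrow> noncrossing n T \<and> card T = n"
proof
  assume T: "noncrossing n T \<and> card T = n"
  then obtain T' where T': "T \<subseteq> T'" "triangulation n T'"
    using noncrossing_extend by blast
  then have "T = T'"
    using T triangulation_card[OF T'(2)] noncrossing_finite triangulation_noncrossing card_subset_eq
    by metis
  then show "triangulation n T"
    using T' by simp
qed (simp add: triangulation_noncrossing triangulation_card)

lemma triangulation_exists: "\<exists>T. triangulation n T"
  using noncrossing_extend[of n "{}"] by (auto simp: noncrossing_def)

section \<open>Quadrilaterals and the exchange of their diagonals\<close>

text \<open>Only the four sides are required, and neither diagonal, so the condition survives the
  exchange of one diagonal for the other.\<close>

definition quad :: "nat \<Rightarrow> nat set set \<Rightarrow> nat \<Rightarrow> nat \<Rightarrow> nat \<Rightarrow> nat \<Rightarrow> bool" where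
  "quad n T p q r s \<longleftrightarrow> seg n T p q \<and> seg n T q r \<and> seg n T r s \<and> seg n T p s"

definition quad_diagonals :: "nat \<Rightarrow> nat set set \<Rightarrow> nat set \<Rightarrow> nat set \<Rightarrow> bool" where
  "quad_diagonals n T d d' \<longleftrightarrow> (\<exists>p q r s. quad n T p q r s \<and>
     (d = {p, r} \<and> d' = {q, s} \<or> d = {q, s} \<and> d' = {p, r}))"

lemma quad_less: "quad n T p q r s \<Longrightarrow> p < q \<and> q < r \<and> r < s"
  by (auto simp: quad_def dest: seg_less)

lemma triangle_iff:
  "x < y \<Longrightarrow> y < z \<Longrightarrow> triangle_of n T {x, y, z} \<longleftrightarrow> seg n T x y \<and> seg n T y z \<and> seg n T x z"
  by (auto simp: triangle_of_def seg_def insert_commute)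

lemma triangle_seg:
  assumes "triangle_of n T {x, y, z}"
  shows "x \<noteq> y" "y \<noteq> z" "x \<noteq> z"
    and "x < y \<Longrightarrow> seg n T x y" "y < x \<Longrightarrow> seg n T y x"
    and "y < z \<Longrightarrow> seg n T y z" "z < y \<Longrightarrow> seg n T z y"
    and "x < z \<Longrightarrow> seg n T x z" "z < x \<Longrightarrow> seg n T z x"
proof -
  have card: "card {x, y, z} = 3"
    using assms by (simp add: triangle_of_def)
  show "x \<noteq> y" "y \<noteq> z" "x \<noteq> z"
    using card by (auto simp: card_insert_if split: if_splits)
  then show "x < y \<Longrightarrow> seg n T x y" "y < x \<Longrightarrow> seg n T y x"
    "y < z \<Longrightarrow> seg n T y z" "z < y \<Longrightarrow> seg n T z y"
    "x < z \<Longrightarrow> seg n T x z" "z < x \<Longrightarrow> seg n T z x"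
    using assms by (auto simp: triangle_of_def seg_def)
qed

text \<open>Of the third vertices of the two triangles on a diagonal, exactly one lies between its
  endpoints.\<close>

lemma two_triangles_quad:
  assumes nc: "noncrossing n T" and "a < c" "b \<noteq> f"
    and abc: "triangle_of n T {a, b, c}" and acf: "triangle_of n T {a, c, f}"
  shows "quad_diagonals n T {a, c} {b, f}"
proof -
  note segs = triangle_seg[OF abc] triangle_seg[OF acf]
  note cross = seg_noncrossing[OF nc]
  have "b < a \<or> a < b \<and> b < c \<or> c < b" "f < a \<or> a < f \<and> f < c \<or> c < f"
    using segs(1,2) segs(11,12) by linarith+
  then consider "b < a" "f < a" | "b < a" "a < f" "f < c" | "b < a" "c < f"
    | "a < b" "b < c" "f < a" | "a < b" "b < c" "a < f" "f < c" | "a < b" "b < c" "c < f"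
    | "c < b" "f < a" | "c < b" "a < f" "f < c" | "c < b" "c < f"
    by blast
  then show ?thesis
  proof cases
    case 1
    then show ?thesis
      using segs \<open>a < c\<close> \<open>b \<noteq> f\<close> cross[of b a f c] cross[of f a b c] by (cases "b < f") auto
  next
    case 2
    then have "quad n T b a f c"
      using segs \<open>a < c\<close> by (simp add: quad_def)
    then show ?thesis
      unfolding quad_diagonals_def by blast
  next
    case 3
    then show ?thesis
      using segs \<open>a < c\<close> cross[of b c a f] by auto
  next
    case 4
    then have "quad n T f a b c"
      using segs \<open>a < c\<close> by (simp add: quad_def)
    then show ?thesis
      unfolding quad_diagonals_def by blast
  next
    case 5
    then show ?thesis
      using segs \<open>b \<noteq> f\<close> cross[of a b f c] cross[of a f b c] by (cases "b < f") auto
  next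
    case 6
    then have "quad n T a b c f"
      using segs \<open>a < c\<close> by (simp add: quad_def)
    then show ?thesis
      unfolding quad_diagonals_def by blast
  next
    case 7
    then show ?thesis
      using segs \<open>a < c\<close> cross[of f c a b] by auto
  next
    case 8
    then have "quad n T a f c b"
      using segs \<open>a < c\<close> by (simp add: quad_def)
    then show ?thesis
      unfolding quad_diagonals_def by blast
  next
    case 9
    then show ?thesis
      using segs \<open>a < c\<close> \<open>b \<noteq> f\<close> cross[of a b c f] cross[of a f c b] by (cases "b < f") auto
  qed
qed

text \<open>Passes from corners in arbitrary order to increasing ones, where crossings are
  inequalities. The diagonal \<open>d\<close> is \<open>{p, r}\<close> or \<open>{q, s}\<close>
  according to whether its outer apex comes after or before it.\<close>

lemma opposite_diagonal_iff:
  assumes nc: "noncrossing n T"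
  shows "opposite_diagonal n T d d' \<longleftrightarrow> d \<in> T \<and> quad_diagonals n T d d'"
proof
  assume "opposite_diagonal n T d d'"
  then obtain a b c f where d: "d \<in> T" "d = {a, c}" "d' = {b, f}" "b \<noteq> f"
    and tri: "triangle_of n T {a, b, c}" "triangle_of n T {a, c, f}"
    unfolding opposite_diagonal_def by blast
  have "a \<noteq> c"
    using triangle_seg[OF tri(1)] by blast
  moreover have "triangle_of n T {c, b, a}" "triangle_of n T {c, a, f}"
    using tri by (simp_all add: insert_commute)
  ultimately have "quad_diagonals n T {a, c} {b, f} \<or> quad_diagonals n T {c, a} {b, f}"
    using two_triangles_quad[OF nc _ d(4)] tri by (metis linorder_neqE_nat)
  then show "d \<in> T \<and> quad_diagonals n T d d'"
    using d by (simp add: insert_commute)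
next
  assume "d \<in> T \<and> quad_diagonals n T d d'"
  then obtain p q r s where d: "d \<in> T" and q: "quad n T p q r s"
    and dd: "d = {p, r} \<and> d' = {q, s} \<or> d = {q, s} \<and> d' = {p, r}"
    unfolding quad_diagonals_def by blast
  have less: "p < q" "q < r" "r < s"
    using quad_less[OF q] by auto
  from dd show "opposite_diagonal n T d d'"
  proof
    assume dd: "d = {p, r} \<and> d' = {q, s}"
    then have "triangle_of n T {p, q, r}" "triangle_of n T {p, r, s}"
      using d q less by (simp_all add: triangle_iff quad_def seg_def)
    then show ?thesis
      unfolding opposite_diagonal_def using d dd less less_trans[of q r s]
        less_imp_neq[of p r] less_imp_neq[of q s]
      by metis
  next
    assume dd: "d = {q, s} \<and> d' = {p, r}"
    then have "triangle_of n T {q, r, s}" "triangle_of n T {p, q, s}"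
      using d q less by (simp_all add: triangle_iff quad_def seg_def)
    moreover have "{q, s, p} = {p, q, s}"
      by blast
    ultimately show ?thesis
      unfolding opposite_diagonal_def using d dd less less_trans[of p q r] less_imp_neq[of p r]
      by (metis insert_commute)
  qed
qed

text \<open>The inner and the outer apex of \<open>d\<close> are the other two corners of its
  quadrilateral.\<close>

lemma quad_diagonals_exists:
  assumes T: "triangulation n T" and d: "d \<in> T"
  obtains d' where "quad_diagonals n T d d'"
proof -
  have diag: "d \<in> diagonals n"
    using T d by (auto simp: triangulation_def noncrossing_def)
  then obtain i j where ij: "d = {i, j}" "i < j"
    by (rule diagonalE)
  have seg: "seg n T i j" and "i + 2 \<le> j" "(i, j) \<noteq> (1, n + 3)"
    using d diag ij by (auto simp: seg_def diagonals_iff)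
  obtain b where b: "seg n T i b" "seg n T b j"
    using apex_exists[OF T seg \<open>i + 2 \<le> j\<close>] .
  show thesis
  proof (rule outer_apex_exists[OF T seg \<open>(i, j) \<noteq> (1, n + 3)\<close>])
    fix f assume "seg n T f i" "seg n T f j"
    then have "quad n T f i b j"
      using b by (simp add: quad_def)
    then show thesis
      using that ij unfolding quad_diagonals_def by blast
  next
    fix f assume "seg n T i f" "seg n T j f"
    then have "quad n T i b j f"
      using b by (simp add: quad_def)
    then show thesis
      using that ij unfolding quad_diagonals_def by blast
  qed
qed

text \<open>Two different apexes on the same side of \<open>d\<close> would have crossing legs, and
  so would one outer apex before \<open>d\<close> and another after it. The cases compare the roles
  of \<open>d\<close> in the two quadrilaterals.\<close>

lemma quad_diagonals_unique:
  assumes nc: "noncrossing n T" and "quad_diagonals n T d d'" "quad_diagonals n T d d''"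
  shows "d' = d''"
proof -
  note cross = seg_noncrossing[OF nc]
  obtain p q r s where q: "quad n T p q r s"
    and d: "d = {p, r} \<and> d' = {q, s} \<or> d = {q, s} \<and> d' = {p, r}"
    using assms(2) unfolding quad_diagonals_def by blast
  obtain p' q' r' s' where q': "quad n T p' q' r' s'"
    and d': "d = {p', r'} \<and> d'' = {q', s'} \<or> d = {q', s'} \<and> d'' = {p', r'}"
    using assms(3) unfolding quad_diagonals_def by blast
  have less: "p < q" "q < r" "r < s" "p' < q'" "q' < r'" "r' < s'"
    using quad_less[OF q] quad_less[OF q'] by auto
  note segs = q[unfolded quad_def] q'[unfolded quad_def]
  have "{p, r} = {p', r'} \<Longrightarrow> p' = p \<and> r' = r" "{p, r} = {q', s'} \<Longrightarrow> q' = p \<and> s' = r"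
    "{q, s} = {p', r'} \<Longrightarrow> p' = q \<and> r' = s" "{q, s} = {q', s'} \<Longrightarrow> q' = q \<and> s' = s"
    using less by (simp_all add: doubleton_less_iff)
  then consider "d = {p, r}" "d' = {q, s}" "p' = p" "r' = r" "d'' = {q', s'}"
    | "d = {p, r}" "d' = {q, s}" "q' = p" "s' = r" "d'' = {p', r'}"
    | "d = {q, s}" "d' = {p, r}" "p' = q" "r' = s" "d'' = {q', s'}"
    | "d = {q, s}" "d' = {p, r}" "q' = q" "s' = s" "d'' = {p', r'}"
    using d d' by metis
  then show ?thesis
  proof cases
    case 1
    have "\<not> q < q'" "\<not> q' < q" "\<not> s < s'" "\<not> s' < s"
      using cross[of p q' q r] cross[of p q q' r] cross[of p s r s'] cross[of p s' r s] segs less 1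
      by auto
    then show ?thesis
      using 1 by simp
  next
    case 2
    then show ?thesis
      using cross[of p' r p s] segs less by auto
  next
    case 3
    then show ?thesis
      using cross[of p s q s'] segs less by auto
  next
    case 4
    have "\<not> r < r'" "\<not> r' < r" "\<not> p < p'" "\<not> p' < p"
      using cross[of q r' r s] cross[of q r r' s] cross[of p q p' s] cross[of p' q p s] segs less 4
      by auto
    then show ?thesis
      using 4 by simp
  qed
qed

lemma quad_diagonals_cross:
  assumes "quad_diagonals n T d d'"
  shows "crosses d d'"
  using assms quad_less unfolding quad_diagonals_def crosses_def by metis

text \<open>A diagonal crossing \<open>d'\<close> runs through the quadrilateral; as it cannot cross
  the four sides, it joins the two corners off \<open>d'\<close>.\<close>

lemma quad_only_crossing:
  assumes nc: "noncrossing n T" and dd: "quad_diagonals n T d d'" and e: "e \<in> T" "crosses d' e"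
  shows "e = d"
proof -
  note cross = seg_noncrossing[OF nc]
  obtain p q r s where q: "quad n T p q r s"
    and d: "d = {p, r} \<and> d' = {q, s} \<or> d = {q, s} \<and> d' = {p, r}"
    using dd unfolding quad_diagonals_def by blast
  have less: "p < q" "q < r" "r < s"
    using quad_less[OF q] by auto
  have segs: "seg n T p q" "seg n T q r" "seg n T r s" "seg n T p s"
    using q by (simp_all add: quad_def)
  have "e \<in> diagonals n"
    using nc e by (auto simp: noncrossing_def)
  then obtain k l where kl: "e = {k, l}" "k < l"
    by (rule diagonalE)
  then have seg: "seg n T k l"
    using e by (simp add: seg_def)
  have nc1: "\<not> (x < k \<and> k < y \<and> y < l)" "\<not> (k < x \<and> x < l \<and> l < y)" if "seg n T x y" for x y
    using cross[OF that seg] cross[OF seg that] by blast+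
  note nc' = nc1[OF segs(1)] nc1[OF segs(2)] nc1[OF segs(3)] nc1[OF segs(4)]
  from d show ?thesis
  proof
    assume d: "d = {p, r} \<and> d' = {q, s}"
    then have "q < k \<and> k < s \<and> s < l \<or> k < q \<and> q < l \<and> l < s"
      using e kl less by (simp add: crosses_iff)
    then have "k = p \<and> l = r"
      using nc' less kl(2) by linarith
    then show ?thesis
      using d kl by simp
  next
    assume d: "d = {q, s} \<and> d' = {p, r}"
    then have "p < k \<and> k < r \<and> r < l \<or> k < p \<and> p < l \<and> l < r"
      using e kl less by (simp add: crosses_iff)
    then have "k = q \<and> l = s"
      using nc' less kl(2) by linarith
    then show ?thesis
      using d kl by simp
  qed
qed

lemma seg_flip: "seg n T i j \<Longrightarrow> {i, j} \<noteq> d \<Longrightarrow> seg n (insert d' (T - {d})) i j"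
  by (auto simp: seg_def)

lemma quad_diagonals_flip:
  assumes "quad_diagonals n T d d'"
  shows "quad_diagonals n (insert d' (T - {d})) d' d"
proof -
  obtain p q r s where q: "quad n T p q r s"
    and d: "d = {p, r} \<and> d' = {q, s} \<or> d = {q, s} \<and> d' = {p, r}"
    using assms unfolding quad_diagonals_def by blast
  have "p < q" "q < r" "r < s"
    using quad_less[OF q] by auto
  then have "quad n (insert d' (T - {d})) p q r s"
    using q d unfolding quad_def by (auto intro!: seg_flip simp: doubleton_eq_iff)
  then show ?thesis
    using d unfolding quad_diagonals_def by blast
qed

text \<open>Nothing but \<open>d\<close> crosses \<open>d'\<close>, so the exchange preserves both
  noncrossing and the cardinality \<open>n\<close>.\<close>

lemma flip_triangulation:
  assumes T: "triangulation n T" and d: "d \<in> T" and dd: "quad_diagonals n T d d'"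
  shows "d' \<notin> T" "triangulation n (insert d' (T - {d}))"
proof -
  have nc: "noncrossing n T"
    using T by (rule triangulation_noncrossing)
  show "d' \<notin> T"
    using nc d quad_diagonals_cross[OF dd] unfolding noncrossing_def by blast
  obtain p q r s where q: "quad n T p q r s"
    and d': "d = {p, r} \<and> d' = {q, s} \<or> d = {q, s} \<and> d' = {p, r}"
    using dd unfolding quad_diagonals_def by blast
  have "1 \<le> p" "p < q" "q < r" "r < s" "s \<le> n + 3"
    using q seg_bounds[OF nc] by (auto simp: quad_def)
  then have "d' \<in> diagonals n"
    using d' by (auto simp: diagonals_iff)
  moreover have "\<not> crosses d' e" if "e \<in> T - {d}" for e
    using quad_only_crossing[OF nc dd] that by blast
  ultimately have "noncrossing n (insert d' (T - {d}))"
    using noncrossing_subset[OF nc] by (intro noncrossing_insert) auto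
  moreover have "card (insert d' (T - {d})) = n"
    using triangulation_card[OF T] noncrossing_finite[OF nc] d \<open>d' \<notin> T\<close> card_gt_0_iff[of T]
    by (auto simp: card_Diff_singleton)
  ultimately show "triangulation n (insert d' (T - {d}))"
    by (simp add: triangulation_iff_card)
qed


section \<open>The colorful exchange graph\<close>

lemma colored_triangulation:
  assumes "t \<in> colored_triangulations n R"
  shows "triangulation n (dom t)" "noncrossing n (dom t)" "ran t \<subseteq> R" "inj_on t (dom t)"
    "card (dom t) = n" "finite (dom t)"
  using assms triangulation_noncrossing triangulation_card triangulation_finite
  by (auto simp: colored_triangulations_def)

lemma flips_to_iff:
  assumes "t \<in> colored_triangulations n R"
  shows "flips_to n t d t' \<longleftrightarrow>
    (\<exists>d'. d \<in> dom t \<and> quad_diagonals n (dom t) d d' \<and> t' = t(d := None, d' := t d))"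
  unfolding flips_to_def by (simp add: opposite_diagonal_iff colored_triangulation[OF assms])

lemma flip_colored:
  assumes t: "t \<in> colored_triangulations n R" and d: "d \<in> dom t"
    and dd: "quad_diagonals n (dom t) d d'"
  shows "d' \<notin> dom t" and "dom (t(d := None, d' := t d)) = insert d' (dom t - {d})"
    and "t(d := None, d' := t d) \<in> colored_triangulations n R"
    and "flips_to n (t(d := None, d' := t d)) d' t"
proof -
  let ?t = "t(d := None, d' := t d)"
  have T: "triangulation n (dom t)"
    using t by (rule colored_triangulation)
  show d': "d' \<notin> dom t"
    using T d dd by (rule flip_triangulation)
  show dom: "dom ?t = insert d' (dom t - {d})"
    using d by auto
  have "ran ?t \<subseteq> ran t"
    by (auto simp: ran_def split: if_splits)
  moreover have "inj_on ?t (dom ?t)"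
    using colored_triangulation(4)[OF t] d d' unfolding dom inj_on_def by auto
  ultimately show t': "?t \<in> colored_triangulations n R"
    using t flip_triangulation(2)[OF T d dd] unfolding dom colored_triangulations_def mem_Collect_eq
    by blast
  have "quad_diagonals n (dom ?t) d' d"
    unfolding dom using dd by (rule quad_diagonals_flip)
  \<comment> \<open>The reverse exchange restores the color too, because \<open>d'\<close> carries
    the color of \<open>d\<close>.\<close>
  moreover have "t = ?t(d' := None, d := ?t d')"
    using d d' by (auto simp: fun_eq_iff)
  ultimately show "flips_to n ?t d' t"
    unfolding flips_to_iff[OF t'] dom by blast
qed

text \<open>The domain differences recover the flipped diagonal and its replacement from the two
  colorings alone, so an edge determines its flip, and its color in either direction.\<close>

lemma flips_to_reverse:
  assumes t: "t \<in> colored_triangulations n R" and "flips_to n t d t'"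
  obtains d' where "t' \<in> colored_triangulations n R" "flips_to n t' d' t" "t' d' = t d"
    "dom t - dom t' = {d}" "dom t' - dom t = {d'}"
proof -
  obtain d' where d: "d \<in> dom t" "quad_diagonals n (dom t) d d'" "t' = t(d := None, d' := t d)"
    using assms(2) unfolding flips_to_iff[OF t] by blast
  note flip = flip_colored[OF t d(1,2), folded d(3)]
  show thesis
  proof (rule that[OF flip(3,4)])
    show "t' d' = t d"
      using d(3) by simp
    show "dom t - dom t' = {d}" "dom t' - dom t = {d'}"
      unfolding flip(2) using flip(1) d(1) by blast+
  qed
qed

lemma flips_to_unique:
  assumes "t \<in> colored_triangulations n R" "flips_to n t d t'" "flips_to n t d t''"
  shows "t' = t''"
proof -
  obtain d' d'' where "quad_diagonals n (dom t) d d'" "t' = t(d := None, d' := t d)"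
    and "quad_diagonals n (dom t) d d''" "t'' = t(d := None, d'' := t d)"
    using assms(2,3) unfolding flips_to_iff[OF assms(1)] by blast
  then show ?thesis
    using quad_diagonals_unique[OF colored_triangulation(2)[OF assms(1)], of d d' d''] by simp
qed

lemma exchange_edge_iff:
  assumes t: "t \<in> colored_triangulations n R"
  shows "{t, t'} \<in> exchange_edges n R \<longleftrightarrow> (\<exists>d. flips_to n t d t')"
proof
  assume "{t, t'} \<in> exchange_edges n R"
  then obtain u u' d where u: "{t, t'} = {u, u'}" "u \<in> colored_triangulations n R" "flips_to n u d u'"
    unfolding exchange_edges_def by blast
  obtain d' where "flips_to n u' d' u"
    using u(2,3) by (rule flips_to_reverse)
  then show "\<exists>d. flips_to n t d t'"
    using u by (auto simp: doubleton_eq_iff)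
next
  assume "\<exists>d. flips_to n t d t'"
  then obtain d where d: "flips_to n t d t'"
    by blast
  then have "t' \<in> colored_triangulations n R"
    using t by (auto elim: flips_to_reverse)
  then show "{t, t'} \<in> exchange_edges n R"
    using t d unfolding exchange_edges_def by blast
qed

lemma exchange_edge_at:
  assumes "e \<in> exchange_edges n R" "t \<in> e"
  obtains d t' where "t \<in> colored_triangulations n R" "flips_to n t d t'" "e = {t, t'}"
proof -
  obtain u u' d where u: "e = {u, u'}" "u \<in> colored_triangulations n R" "flips_to n u d u'"
    using assms(1) unfolding exchange_edges_def by blast
  obtain d' where d': "u' \<in> colored_triangulations n R" "flips_to n u' d' u"
    using u(2,3) by (rule flips_to_reverse)
  show thesis
  proof (cases "t = u")
    case True
    then show thesis
      using u that by blast
  next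
    case False
    then have "t = u'"
      using u assms(2) by blast
    then show thesis
      using u d' that[of d' u] by (simp add: insert_commute)
  qed
qed

lemma exchange_color_eq:
  assumes t: "t \<in> colored_triangulations n R" and flip: "flips_to n t d t'"
  shows "Some (exchange_color n R {t, t'}) = t d"
proof -
  obtain d' where d': "t' \<in> colored_triangulations n R" "flips_to n t' d' t" "t' d' = t d"
    "dom t - dom t' = {d}" "dom t' - dom t = {d'}"
    using t flip by (rule flips_to_reverse)
  then have "d \<in> dom t"
    by blast
  then obtain k where k: "t d = Some k"
    by blast
  have "exchange_color n R {t, t'} = k"
    unfolding exchange_color_def
  proof (rule the_equality)
    show "\<exists>u u' e. {t, t'} = {u, u'} \<and> u \<in> colored_triangulations n R \<and>
      u' \<in> colored_triangulations n R \<and> flips_to n u e u' \<and> u e = Some k"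
      using t d' flip k by blast
  next
    fix k' assume "\<exists>u u' e. {t, t'} = {u, u'} \<and> u \<in> colored_triangulations n R \<and>
      u' \<in> colored_triangulations n R \<and> flips_to n u e u' \<and> u e = Some k'"
    then obtain u u' e where u: "{t, t'} = {u, u'}" "u \<in> colored_triangulations n R"
      "flips_to n u e u'" "u e = Some k'"
      by blast
    have e: "dom u - dom u' = {e}"
      using flips_to_reverse[OF u(2,3)] by metis
    \<comment> \<open>The unordered edge can be read in two directions; the backward one flips
      \<open>d'\<close>, which has the color of \<open>d\<close>.\<close>
    have "u = t \<and> u' = t' \<or> u = t' \<and> u' = t"
      using u(1) by (auto simp: doubleton_eq_iff)
    then show "k' = k"
    proof
      assume "u = t \<and> u' = t'"
      then show ?thesis
        using e d'(4) u(4) k by simp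
    next
      assume "u = t' \<and> u' = t"
      then show ?thesis
        using e d'(3,5) u(4) k by simp
    qed
  qed
  then show ?thesis
    using k by simp
qed

text \<open>The edges at \<open>t\<close> correspond to its \<open>n\<close> diagonals, since
  \<open>dom t - dom t'\<close> recovers the flipped one. Equal colors at \<open>t\<close> mean the
  same diagonal, as colorings are injective.\<close>

lemma exchange_graph_regular:
  assumes "finite R" "card R = n"
  shows "properly_edge_colored_regular_graph n R (colored_triangulations n R) (exchange_edges n R)
    (exchange_color n R)"
  unfolding properly_edge_colored_regular_graph_def
proof (intro conjI ballI impI)
  let ?V = "colored_triangulations n R" and ?E = "exchange_edges n R"
  fix e assume "e \<in> ?E"
  then obtain t t' d where e: "e = {t, t'}" "t \<in> ?V" "flips_to n t d t'"
    unfolding exchange_edges_def by blast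
  obtain d' where d': "t' \<in> ?V" "dom t - dom t' = {d}"
    using flips_to_reverse[OF e(2,3)] by metis
  moreover have "t \<noteq> t'"
    using d'(2) by blast
  ultimately show "e \<subseteq> ?V" "card e = 2"
    using e by auto
  have "Some (exchange_color n R e) = t d"
    unfolding e(1) using e(2,3) by (rule exchange_color_eq)
  then have "exchange_color n R e \<in> ran t"
    unfolding ran_def by (auto dest: sym)
  then show "exchange_color n R e \<in> R"
    using colored_triangulation(3)[OF e(2)] by blast
next
  let ?V = "colored_triangulations n R" and ?E = "exchange_edges n R"
  fix t assume t: "t \<in> ?V"
  have "\<exists>t'. flips_to n t d t'" if "d \<in> dom t" for d
    using quad_diagonals_exists[OF colored_triangulation(1)[OF t] that] that
    unfolding flips_to_iff[OF t] by metis
  then obtain nb where nb: "\<And>d. d \<in> dom t \<Longrightarrow> flips_to n t d (nb d)"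
    by metis
  have "{e \<in> ?E. t \<in> e} = (\<lambda>d. {t, nb d}) ` dom t"
  proof (intro set_eqI iffI)
    fix e assume "e \<in> {e \<in> ?E. t \<in> e}"
    then obtain d t' where d: "flips_to n t d t'" "e = {t, t'}"
      using exchange_edge_at by blast
    then have "d \<in> dom t"
      unfolding flips_to_iff[OF t] by blast
    then have "t' = nb d"
      using flips_to_unique[OF t d(1)] nb by blast
    then show "e \<in> (\<lambda>d. {t, nb d}) ` dom t"
      using d \<open>d \<in> dom t\<close> by blast
  next
    fix e assume "e \<in> (\<lambda>d. {t, nb d}) ` dom t"
    then show "e \<in> {e \<in> ?E. t \<in> e}"
      using nb exchange_edge_iff[OF t] by blast
  qed
  moreover have "inj_on (\<lambda>d. {t, nb d}) (dom t)"
  proof (rule inj_onI)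
    fix d d' assume d: "d \<in> dom t" "d' \<in> dom t" "{t, nb d} = {t, nb d'}"
    then have nb_eq: "nb d = nb d'"
      unfolding doubleton_eq_iff by blast
    have "dom t - dom (nb d) = {d}"
      by (rule flips_to_reverse[OF t nb[OF d(1)]])
    moreover have "dom t - dom (nb d') = {d'}"
      by (rule flips_to_reverse[OF t nb[OF d(2)]])
    ultimately have "{d} = {d'}"
      unfolding nb_eq by (rule subst)
    then show "d = d'"
      by (rule singleton_inject)
  qed
  ultimately show "finite {e \<in> ?E. t \<in> e}" "card {e \<in> ?E. t \<in> e} = n"
    using colored_triangulation(5,6)[OF t] by (simp_all add: card_image)
next
  fix e e' assume e: "e \<in> exchange_edges n R" "e' \<in> exchange_edges n R" and "e \<noteq> e' \<and> e \<inter> e' \<noteq> {}"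
  then obtain t where te: "e \<noteq> e'" "t \<in> e" "t \<in> e'"
    by blast
  obtain d u where t: "t \<in> colored_triangulations n R" and d: "flips_to n t d u" "e = {t, u}"
    using e(1) te(2) by (rule exchange_edge_at)
  obtain d' u' where d': "flips_to n t d' u'" "e' = {t, u'}"
    using e(2) te(3) by (rule exchange_edge_at)
  show "exchange_color n R e \<noteq> exchange_color n R e'"
  proof
    assume "exchange_color n R e = exchange_color n R e'"
    then have "t d = t d'"
      using exchange_color_eq[OF t d(1)] exchange_color_eq[OF t d'(1)] d(2) d'(2) by metis
    moreover have "d \<in> dom t" "d' \<in> dom t"
      using d(1) d'(1) unfolding flips_to_iff[OF t] by blast+
    ultimately have "d = d'"
      using colored_triangulation(4)[OF t] by (auto dest: inj_onD)
    then show False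
      using flips_to_unique[OF t] d d' te(1) by metis
  qed
qed (use assms in auto)

section \<open>Connectedness by way of the fan\<close>

abbreviation flip_reachable :: "nat \<Rightarrow> 'c set \<Rightarrow> (nat set \<rightharpoonup> 'c) rel" where
  "flip_reachable n R \<equiv> {(t, t'). {t, t'} \<in> exchange_edges n R}\<^sup>*"

lemma flip_reachable_sym:
  assumes "(t, t') \<in> flip_reachable n R"
  shows "(t', t) \<in> flip_reachable n R"
proof -
  have "sym {(t, t'). {t, t'} \<in> exchange_edges n R}"
    by (auto simp: sym_def insert_commute)
  then show ?thesis
    using assms by (meson sym_rtrancl symD)
qed

lemma flip_step:
  assumes t: "t \<in> colored_triangulations n R" and d: "d \<in> dom t"
    and dd: "quad_diagonals n (dom t) d d'"
  shows "(t, t(d := None, d' := t d)) \<in> flip_reachable n R"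
proof -
  have "flips_to n t d (t(d := None, d' := t d))"
    using d dd flips_to_iff[OF t] by blast
  then show ?thesis
    using exchange_edge_iff[OF t] by blast
qed

lemma quad_diagonalsI:
  assumes "seg n T p q" "seg n T q r" "seg n T r s" "seg n T p s"
  shows "quad_diagonals n T {p, r} {q, s}" "quad_diagonals n T {q, s} {p, r}"
  using assms unfolding quad_diagonals_def quad_def by blast+

text \<open>Vertices 2 and \<open>n + 3\<close> are joined to 1 by sides, so the diagonals from 1
  end at \<open>3, ..., n + 2\<close>; hence the shift by 3.\<close>

definition fan :: "nat \<Rightarrow> nat set set" where
  "fan n = (\<lambda>i. {1, i + 3}) ` {..<n}"

lemma fan_iff: "i < j \<Longrightarrow> {i, j} \<in> fan n \<longleftrightarrow> i = 1 \<and> 3 \<le> j \<and> j < n + 3"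
  by (auto simp: fan_def doubleton_eq_iff image_iff intro!: bexI[of _ "j - 3"])

lemma fan_eq:
  assumes T: "triangulation n T" and sub: "fan n \<subseteq> T"
  shows "T = fan n"
proof (rule card_subset_eq[symmetric])
  have "inj_on (\<lambda>i. {1 :: nat, i + 3}) {..<n}"
    by (auto simp: inj_on_def doubleton_eq_iff)
  then show "card (fan n) = card T"
    unfolding fan_def triangulation_card[OF T] by (simp add: card_image)
qed (use T sub triangulation_finite in auto)

text \<open>Outside the fan, 1 is joined to some \<open>j + 1\<close> but not to \<open>j\<close>.
  The inner apex \<open>b\<close> of \<open>(1, j + 1)\<close> is then less than \<open>j\<close>,
  so \<open>{b, j + 1}\<close> is a diagonal with inner apex \<open>c\<close>, and its flip is
  \<open>{1, c}\<close>.\<close>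

lemma flip_towards_fan:
  assumes T: "triangulation n T" and "T \<noteq> fan n"
  obtains d d' where "d \<in> T - fan n" "quad_diagonals n T d d'" "d' \<in> fan n - T"
proof -
  have nc: "noncrossing n T"
    using T by (rule triangulation_noncrossing)
  have "\<exists>j. seg n T 1 (Suc j) \<and> 2 \<le> j \<and> \<not> seg n T 1 j"
  proof (rule ccontr)
    assume down: "\<nexists>j. seg n T 1 (Suc j) \<and> 2 \<le> j \<and> \<not> seg n T 1 j"
    have seg: "seg n T 1 j" if "2 \<le> j" "j \<le> n + 3" for j
      using that(2,1)
    proof (induction rule: inc_induct)
      case base
      then show ?case
        using seg_root by simp
    next
      case (step j)
      then show ?case
        using down by auto
    qed
    have "{1, i + 3} \<in> T" if "i < n" for i
      using seg[of "i + 3"] that by (auto simp: seg_def sides_iff)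
    then have "fan n \<subseteq> T"
      by (auto simp: fan_def)
    then show False
      using fan_eq[OF T] assms(2) by blast
  qed
  then obtain j where j: "seg n T 1 (Suc j)" "2 \<le> j" "\<not> seg n T 1 j"
    by blast
  obtain b where b: "seg n T 1 b" "seg n T b (Suc j)"
    using apex_exists[OF T j(1)] j(2) by auto
  have "b \<noteq> j"
    using b j by blast
  then have bj: "1 < b" "b < j"
    using b seg_less by fastforce+
  obtain c where c: "seg n T b c" "seg n T c (Suc j)"
    using apex_exists[OF T b(2)] bj by auto
  have less: "b < c" "c < Suc j" "Suc j \<le> n + 3"
    using c seg_less seg_bounds[OF nc j(1)] by blast+
  have dd: "quad_diagonals n T {b, Suc j} {1, c}"
    by (rule quad_diagonalsI) (use b c j in auto)
  have "{b, Suc j} \<in> T"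
    using b(2) bj less by (auto simp: seg_def sides_iff)
  moreover have "{b, Suc j} \<notin> fan n" "{1, c} \<in> fan n"
    using bj less by (subst fan_iff; simp)+
  moreover have "{1, c} \<notin> T"
    using flip_triangulation(1)[OF T _ dd] \<open>{b, Suc j} \<in> T\<close> .
  ultimately show thesis
    using that dd by blast
qed

text \<open>Each flip gains a fan diagonal and gives up a diagonal outside the fan, so fewer fan
  diagonals are missing.\<close>

lemma fan_reachable:
  assumes "t \<in> colored_triangulations n R"
  obtains t' where "t' \<in> colored_triangulations n R" "dom t' = fan n" "(t, t') \<in> flip_reachable n R"
proof -
  have "\<exists>t'. t' \<in> colored_triangulations n R \<and> dom t' = fan n \<and> (t, t') \<in> flip_reachable n R"
    using assms
  proof (induction "card (fan n - dom t)" arbitrary: t rule: less_induct)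
    case less
    show ?case
    proof (cases "dom t = fan n")
      case True
      then show ?thesis
        using less.prems by blast
    next
      case False
      then obtain d d' where d: "d \<in> dom t - fan n" and dd: "quad_diagonals n (dom t) d d'"
        and d': "d' \<in> fan n - dom t"
        using flip_towards_fan colored_triangulation(1)[OF less.prems] by blast
      let ?t = "t(d := None, d' := t d)"
      note flip = flip_colored[OF less.prems _ dd]
      have "fan n - dom ?t \<subset> fan n - dom t"
        using flip(2) d d' by auto
      then have "card (fan n - dom ?t) < card (fan n - dom t)"
        by (intro psubset_card_mono) (auto simp: fan_def)
      moreover have "?t \<in> colored_triangulations n R"
        using flip(3) d by blast
      ultimately obtain t' where t': "t' \<in> colored_triangulations n R" "dom t' = fan n"
        "(?t, t') \<in> flip_reachable n R"
        using less.hyps[of ?t] by blast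
      have "(t, ?t) \<in> flip_reachable n R"
        using flip_step[OF less.prems _ dd] d by simp
      then show ?thesis
        using t'(1,2) rtrancl_trans[OF _ t'(3)] by blast
    qed
  qed
  then show thesis
    using that by blast
qed

text \<open>The color of \<open>{a, c}\<close> travels through \<open>{b, d}\<close> and
  \<open>{c, e}\<close> to \<open>{a, d}\<close>, and that of \<open>{a, d}\<close> through
  \<open>{b, e}\<close> to \<open>{a, c}\<close>, in alternating flips.\<close>

lemma pentagon_swap:
  assumes t: "t \<in> colored_triangulations n R"
    and segs: "seg n (dom t) a b" "seg n (dom t) b c" "seg n (dom t) c d" "seg n (dom t) d e"
      "seg n (dom t) a e"
    and ac: "{a, c} \<in> dom t" and ad: "{a, d} \<in> dom t"
  defines "t' \<equiv> t({a, c} := t {a, d}, {a, d} := t {a, c})"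
  shows "t' \<in> colored_triangulations n R" "(t, t') \<in> flip_reachable n R"
proof -
  have less: "a < b" "b < c" "c < d" "d < e" "a < c" "a < d" "a < e" "b < d" "b < e" "c < e"
    using segs(1-4)[THEN seg_less] by linarith+
  have neq: "{a, c} \<noteq> {a, d}" "{a, c} \<noteq> {b, d}" "{a, c} \<noteq> {b, e}" "{a, c} \<noteq> {c, e}"
    "{a, d} \<noteq> {b, d}" "{a, d} \<noteq> {b, e}" "{a, d} \<noteq> {c, e}" "{b, d} \<noteq> {b, e}"
    "{b, d} \<noteq> {c, e}" "{b, e} \<noteq> {c, e}"
    using less by (simp_all add: doubleton_less_iff)
  have side_neq: "x \<noteq> {a, c} \<and> x \<noteq> {a, d}" if "x \<in> {{a, b}, {b, c}, {c, d}, {d, e}, {a, e}}" for x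
    using that less by (elim insertE emptyE) (simp_all add: doubleton_less_iff)
  have nc: "noncrossing n (dom t)"
    using t by (rule colored_triangulation)
  have ac': "seg n (dom t) a c" and ad': "seg n (dom t) a d"
    using ac ad less by (auto simp: seg_def)
  have "\<not> seg n (dom t) b d" "\<not> seg n (dom t) b e" "\<not> seg n (dom t) c e"
    using seg_noncrossing[OF nc ac'] seg_noncrossing[OF nc ad'] less by blast+
  \<comment> \<open>The other three diagonals of the pentagon start uncolored, so clearing them
    again restores \<open>t\<close> outside the two swapped values.\<close>
  then have None: "t {b, d} = None" "t {b, e} = None" "t {c, e} = None"
    using less by (auto simp: seg_def)
  define t1 where "t1 = t({a, c} := None, {b, d} := t {a, c})"
  define t2 where "t2 = t1({a, d} := None, {b, e} := t1 {a, d})"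
  define t3 where "t3 = t2({b, d} := None, {c, e} := t2 {b, d})"
  define t4 where "t4 = t3({b, e} := None, {a, c} := t3 {b, e})"
  define t5 where "t5 = t4({c, e} := None, {a, d} := t4 {c, e})"
  \<comment> \<open>Shared by all stages: a coloring whose domain loses at most the two inner
    diagonals of \<open>t\<close> still has the five sides of the pentagon.\<close>
  have sides: "seg n (dom u) a b" "seg n (dom u) b c" "seg n (dom u) c d" "seg n (dom u) d e"
    "seg n (dom u) a e" if "dom t - {{a, c}, {a, d}} \<subseteq> dom u" for u :: "nat set \<rightharpoonup> 'c"
  proof -
    have "seg n (dom u) i j" if "seg n (dom t) i j" "{i, j} \<in> {{a, b}, {b, c}, {c, d}, {d, e}, {a, e}}" for i j
      using that(1) side_neq[OF that(2)] \<open>dom t - {{a, c}, {a, d}} \<subseteq> dom u\<close> unfolding seg_def by blast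
    then show "seg n (dom u) a b" "seg n (dom u) b c" "seg n (dom u) c d" "seg n (dom u) d e"
      "seg n (dom u) a e"
      using segs by simp_all
  qed
  have q0: "quad_diagonals n (dom t) {a, c} {b, d}"
    using segs(1-3) ad' by (rule quad_diagonalsI)
  have t1: "t1 \<in> colored_triangulations n R" "(t, t1) \<in> flip_reachable n R"
    unfolding t1_def using flip_colored(3)[OF t ac q0] flip_step[OF t ac q0] .
  have dom1: "dom t1 = insert {b, d} (dom t - {{a, c}})"
    unfolding t1_def using flip_colored(2)[OF t ac q0] .
  have m1: "{a, d} \<in> dom t1" "{b, d} \<in> dom t1"
    unfolding dom1 using ad neq by simp_all
  have sides1: "dom t - {{a, c}, {a, d}} \<subseteq> dom t1"
    unfolding dom1 using ac None by auto
  have "seg n (dom t1) b d"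
    using m1 less by (simp add: seg_def)
  then have q1: "quad_diagonals n (dom t1) {a, d} {b, e}"
    using sides[OF sides1] by (intro quad_diagonalsI)
  have t2: "t2 \<in> colored_triangulations n R" "(t1, t2) \<in> flip_reachable n R"
    unfolding t2_def using flip_colored(3)[OF t1(1) m1(1) q1] flip_step[OF t1(1) m1(1) q1] .
  have dom2: "dom t2 = insert {b, e} (dom t1 - {{a, d}})"
    unfolding t2_def using flip_colored(2)[OF t1(1) m1(1) q1] .
  have m2: "{b, d} \<in> dom t2" "{b, e} \<in> dom t2"
    unfolding dom2 using m1 neq by simp_all
  have sides2: "dom t - {{a, c}, {a, d}} \<subseteq> dom t2"
    unfolding dom2 using sides1 None by auto
  have "seg n (dom t2) b e"
    using m2 less by (simp add: seg_def)
  then have q2: "quad_diagonals n (dom t2) {b, d} {c, e}"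
    using sides[OF sides2] by (intro quad_diagonalsI)
  have t3: "t3 \<in> colored_triangulations n R" "(t2, t3) \<in> flip_reachable n R"
    unfolding t3_def using flip_colored(3)[OF t2(1) m2(1) q2] flip_step[OF t2(1) m2(1) q2] .
  have dom3: "dom t3 = insert {c, e} (dom t2 - {{b, d}})"
    unfolding t3_def using flip_colored(2)[OF t2(1) m2(1) q2] .
  have m3: "{b, e} \<in> dom t3" "{c, e} \<in> dom t3"
    unfolding dom3 using m2 neq by simp_all
  have sides3: "dom t - {{a, c}, {a, d}} \<subseteq> dom t3"
    unfolding dom3 using sides2 None by auto
  have "seg n (dom t3) c e"
    using m3 less by (simp add: seg_def)
  then have q3: "quad_diagonals n (dom t3) {b, e} {a, c}"
    using sides[OF sides3] by (intro quad_diagonalsI)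
  have t4: "t4 \<in> colored_triangulations n R" "(t3, t4) \<in> flip_reachable n R"
    unfolding t4_def using flip_colored(3)[OF t3(1) m3(1) q3] flip_step[OF t3(1) m3(1) q3] .
  have dom4: "dom t4 = insert {a, c} (dom t3 - {{b, e}})"
    unfolding t4_def using flip_colored(2)[OF t3(1) m3(1) q3] .
  have m4: "{c, e} \<in> dom t4" "{a, c} \<in> dom t4"
    unfolding dom4 using m3 neq by simp_all
  have sides4: "dom t - {{a, c}, {a, d}} \<subseteq> dom t4"
    unfolding dom4 using sides3 None by auto
  have "seg n (dom t4) a c"
    using m4 less by (simp add: seg_def)
  then have q4: "quad_diagonals n (dom t4) {c, e} {a, d}"
    using sides[OF sides4] by (intro quad_diagonalsI)
  have t5: "t5 \<in> colored_triangulations n R" "(t4, t5) \<in> flip_reachable n R"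
    unfolding t5_def using flip_colored(3)[OF t4(1) m4(1) q4] flip_step[OF t4(1) m4(1) q4] .
  have "t5 = t'"
    using None neq neq[symmetric] by (auto simp: fun_eq_iff t'_def t5_def t4_def t3_def t2_def t1_def)
  moreover have "(t, t5) \<in> flip_reachable n R"
    using t1(2) t2(2) t3(2) t4(2) t5(2) by (meson rtrancl_trans)
  ultimately show "t' \<in> colored_triangulations n R" "(t, t') \<in> flip_reachable n R"
    using t5(1) by simp_all
qed

text \<open>The pentagon has corners \<open>1, i + 2, i + 3, i + 4, i + 5\<close>, and
  \<open>Suc i < n\<close> says \<open>i + 5 \<le> n + 3\<close>. Its sides at 1 may be fan
  diagonals or polygon sides, which \<open>seg\<close> treats alike.\<close>

lemma fan_swap:
  assumes t: "t \<in> colored_triangulations n R" "dom t = fan n" and i: "Suc i < n"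
  defines "t' \<equiv> t({1, i + 3} := t {1, Suc i + 3}, {1, Suc i + 3} := t {1, i + 3})"
  shows "t' \<in> colored_triangulations n R" "(t, t') \<in> flip_reachable n R"
proof -
  have Suc_i: "Suc i + 3 = i + 4"
    by simp
  have seg: "seg n (dom t) 1 j" if "2 \<le> j" "j \<le> n + 3" for j
    using that t(2) by (auto simp: seg_def sides_iff fan_iff)
  have "seg n (dom t) (i + 2) (i + 3)" "seg n (dom t) (i + 3) (i + 4)" "seg n (dom t) (i + 4) (i + 5)"
    using i by (auto simp: seg_def sides_iff)
  moreover have "{1, i + 3} \<in> dom t" "{1, i + 4} \<in> dom t"
    using i t(2) by (auto simp: fan_iff)
  ultimately show "t' \<in> colored_triangulations n R" "(t, t') \<in> flip_reachable n R"
    unfolding t'_def Suc_i using i by (intro pentagon_swap[OF t(1), of 1 "i + 2" _ _ "i + 5"] seg; simp)+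
qed

text \<open>Sorting by adjacent transpositions: only positions below \<open>k\<close> may still
  differ, and the color wanted at the last of them is moved there before \<open>k\<close>
  decreases.\<close>

lemma fan_colorings_reachable:
  assumes R: "finite R" "card R = n"
    and t: "t \<in> colored_triangulations n R" "dom t = fan n"
    and t': "t' \<in> colored_triangulations n R" "dom t' = fan n"
  shows "(t, t') \<in> flip_reachable n R"
proof -
  let ?F = "\<lambda>i. {1 :: nat, i + 3}"
  have F_eq: "?F i = ?F j \<longleftrightarrow> i = j" for i j
    by (auto simp: doubleton_eq_iff)
  have F_dom: "?F i \<in> fan n" if "i < n" for i
    using that by (auto simp: fan_def)
  have "(t, t') \<in> flip_reachable n R"
    if "k \<le> n" "t \<in> colored_triangulations n R" "dom t = fan n" "\<And>i. k \<le> i \<Longrightarrow> i < n \<Longrightarrow> t (?F i) = t' (?F i)"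
    for k t
    using that
  proof (induction k arbitrary: t)
    case 0
    have "t = t'"
    proof
      fix d show "t d = t' d"
      proof (cases "d \<in> fan n")
        case True
        then show ?thesis
          using 0 by (auto simp: fan_def)
      next
        case False
        then show ?thesis
          using 0 t'(2) by (metis domIff)
      qed
    qed
    then show ?case
      by simp
  next
    case (Suc k)
    \<comment> \<open>\<open>m\<close> is the distance of the wanted color from its target
      \<open>k\<close>. The swaps touch no position above \<open>k\<close>, so the agreement there
      persists.\<close>
    have bubble: "(t, t') \<in> flip_reachable n R"
      if "t \<in> colored_triangulations n R" "dom t = fan n" "t (?F j) = t' (?F k)" "j + m = k"
        "\<And>i. Suc k \<le> i \<Longrightarrow> i < n \<Longrightarrow> t (?F i) = t' (?F i)" for j m t
      using that
    proof (induction m arbitrary: j t)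
      case 0
      have "t (?F i) = t' (?F i)" if "k \<le> i" "i < n" for i
        using 0 that by (cases "i = k") auto
      then show ?case
        using 0 Suc.prems(1) by (intro Suc.IH) auto
    next
      case (Suc m)
      let ?t = "t(?F j := t (?F (Suc j)), ?F (Suc j) := t (?F j))"
      have j: "Suc j < n" "Suc j \<le> k"
        using Suc.prems \<open>Suc k \<le> n\<close> by auto
      have t: "?t \<in> colored_triangulations n R" "(t, ?t) \<in> flip_reachable n R"
        by (rule fan_swap[OF Suc.prems(1,2) j(1)])+
      have "?F j \<in> dom t" "?F (Suc j) \<in> dom t"
        using j F_dom[of j] F_dom[of "Suc j"] Suc.prems(2) by auto
      then have dom: "dom ?t = fan n"
        using Suc.prems(2) by auto
      have "(?t, t') \<in> flip_reachable n R"
      proof (rule Suc.IH[OF t(1) dom])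
        show "?t (?F (Suc j)) = t' (?F k)"
          using Suc.prems(3) by simp
        show "Suc j + m = k"
          using Suc.prems(4) by simp
        fix i assume i: "Suc k \<le> i" "i < n"
        then have "?F i \<noteq> ?F j" "?F i \<noteq> ?F (Suc j)"
          unfolding F_eq using j by simp_all
        then have "?t (?F i) = t (?F i)"
          by (simp only: fun_upd_other not_False_eq_True)
        then show "?t (?F i) = t' (?F i)"
          using Suc.prems(5)[OF i] by (rule trans)
      qed
      then show ?case
        by (rule rtrancl_trans[OF t(2)])
    qed
    \<comment> \<open>With \<open>n\<close> diagonals of distinct colors and \<open>n\<close>
      colors, all colors are used, so the one wanted at \<open>k\<close> occurs in
      \<open>t\<close>.\<close>
    have "t ` dom t = Some ` R"
    proof (rule card_subset_eq)
      show "t ` dom t \<subseteq> Some ` R"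
        using colored_triangulation(3)[OF Suc.prems(2)] by (auto simp: ran_def)
      show "card (t ` dom t) = card (Some ` R)"
        using colored_triangulation(4,5)[OF Suc.prems(2)] R by (simp add: card_image)
    qed (use R in simp)
    moreover have "?F k \<in> dom t'"
      using F_dom Suc.prems(1) t'(2) by simp
    then have "t' (?F k) \<in> Some ` R"
      using colored_triangulation(3)[OF t'(1)] by (auto simp: ran_def)
    ultimately have "t' (?F k) \<in> t ` ?F ` {..<n}"
      unfolding fan_def[symmetric] Suc.prems(3)[symmetric] by simp
    then obtain j where j: "j < n" "t (?F j) = t' (?F k)"
      unfolding image_iff by force
    \<comment> \<open>Past \<open>k\<close> the two colorings agree, and \<open>t'\<close> is
      injective, so the wanted color cannot sit there.\<close>
    have "j \<le> k"
    proof (rule ccontr)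
      assume "\<not> j \<le> k"
      then have "t' (?F j) = t' (?F k)"
        using Suc.prems(4) j by simp
      moreover have "?F j \<in> dom t'"
        using F_dom j t'(2) by simp
      ultimately have "?F j = ?F k"
        using colored_triangulation(4)[OF t'(1)] \<open>?F k \<in> dom t'\<close> by (auto dest: inj_onD)
      then show False
        using \<open>\<not> j \<le> k\<close> F_eq by simp
    qed
    then show ?case
      using bubble[of t j "k - j"] Suc.prems j by simp
  qed
  from this[of n t] show ?thesis
    using t by simp
qed

lemma exchange_graph_connected:
  assumes R: "finite R" "card R = n"
  shows "connected_graph (colored_triangulations n R) (exchange_edges n R)"
  unfolding connected_graph_def
proof (intro conjI ballI)
  obtain T where T: "triangulation n T"
    using triangulation_exists by blast
  have "finite T" "card T = card R"
    using T R triangulation_card triangulation_finite by auto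
  \<comment> \<open>A triangulation has exactly \<open>card R\<close> diagonals, so it can be
    colored; this gives nonemptiness.\<close>
  then obtain h where h: "bij_betw h T R"
    using R(1) finite_same_card_bij by blast
  let ?t = "\<lambda>d. if d \<in> T then Some (h d) else None"
  have "dom ?t = T"
    by (auto split: if_splits)
  moreover have "ran ?t \<subseteq> R"
    using h by (auto simp: ran_def bij_betw_def split: if_splits)
  moreover have "inj_on ?t T"
    using h by (auto simp: inj_on_def bij_betw_def)
  ultimately have "?t \<in> colored_triangulations n R"
    using T unfolding colored_triangulations_def mem_Collect_eq by metis
  then show "colored_triangulations n R \<noteq> {}"
    by blast
  fix t u assume t: "t \<in> colored_triangulations n R" and u: "u \<in> colored_triangulations n R"
  obtain t' where t': "t' \<in> colored_triangulations n R" "dom t' = fan n" "(t, t') \<in> flip_reachable n R"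
    using t by (rule fan_reachable)
  obtain u' where u': "u' \<in> colored_triangulations n R" "dom u' = fan n" "(u, u') \<in> flip_reachable n R"
    using u by (rule fan_reachable)
  have "(t', u') \<in> flip_reachable n R"
    using R t'(1,2) u'(1,2) by (rule fan_colorings_reachable)
  then show "(t, u) \<in> flip_reachable n R"
    using t'(3) flip_reachable_sym[OF u'(3)] by (meson rtrancl_trans)
qed

text \<open>Connectedness and regularity are included because the construction of a colorful
  polytope presupposes them. The clause on \<open>face_rank\<close> confirms that the rank derived
  from flags is the intended number of colors.\<close>

theorem theorem4:
  fixes n :: nat and R :: "'c set"
  assumes "finite R" and "card R = n"
  shows "connected_graph (colored_triangulations n R) (exchange_edges n R) \<and>
         properly_edge_colored_regular_graph n R
           (colored_triangulations n R) (exchange_edges n R) (exchange_color n R) \<and>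
         simple_abstract_polytope (int n) (colorful_associahedron n R) \<and>
         (\<forall>C X. Some (C, X) \<in> Field (colorful_associahedron n R) \<longrightarrow>
            face_rank (colorful_associahedron n R) (Some (C, X)) = int (card C)) \<and>
         is_one_skeleton (colored_triangulations n R) (exchange_edges n R)
           (colorful_associahedron n R)"
proof -
  interpret colored_graph n R "colored_triangulations n R" "exchange_edges n R" "exchange_color n R"
    using exchange_graph_connected[OF assms] exchange_graph_regular[OF assms]
    by (rule colored_graph.intro)
  show ?thesis
    unfolding colorful_associahedron_def
    using connected regular simple_abstract_polytope_P one_skeleton_P by (simp add: face_rank_P)
qed

end
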